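(* Let $\Omega\subset\mathbb{C}_\infty$ be an open set with $0\in\Omega$ and let $1\le p<2$. If the Taylor shift $T$ on $A^p(\Omega)$ is hypercyclic, then $\Omega^*$ is perfect (that is, the compact set $\Omega^*$ has no isolated points).
   Context: $\mathbb{C}_\infty$ is the Riemann sphere. For $A\subset\mathbb{C}_\infty$, $A^*:=\{1/w: w\in\mathbb{C}_\infty\setminus A\}$ (with $1/0=\infty$, $1/\infty=0$); for $\Omega$ open with $0\in\Omega$, $\Omega^*$ is compact in $\mathbb{C}$. $H(\Omega)$ is the space of functions holomorphic in $\Omega$ (and vanishing at $\infty$ if $\infty\in\Omega$). $m_2$ is the normalized surface measure on the sphere $\mathbb{C}_\infty$; $A^p(\Omega)$ is the Banach space of all $f\in H(\Omega)$ with $\|f\|_p=(\int_\Omega|f|^p\,dm_2)^{1/p}<\infty$. The Taylor shift $T$ is the continuous operator on $A^p(\Omega)$ given by $(Tf)(z)=(f(z)-f(0))/z$ for $z\neq0$, $(Tf)(0)=f'(0)$ (value $0$ at $\infty$ if $\infty\in\Omega$). A continuous linear operator $T$ on a separable Fréchet space $X$ is hypercyclic if some orbit $\{T^nx:n\ge0\}$ is dense in $X$. *)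

theory Defs
  imports "HOL-Complex_Analysis.Complex_Analysis"
begin

text \<open>The Riemann sphere is the one-point compactification of the complex plane;
  \<open>None\<close> is the point at infinity.\<close>

type_synonym sphere = "complex option"

definition sphere_topology :: "sphere topology" where
  "sphere_topology = Alexandroff_compactification euclidean"

fun sphere_inverse :: "sphere \<Rightarrow> sphere" where
  "sphere_inverse None = Some 0"
| "sphere_inverse (Some z) = (if z = 0 then None else Some (1 / z))"

definition sphere_star :: "sphere set \<Rightarrow> sphere set" where
  "sphere_star A = sphere_inverse ` (- A)"

definition perfect_in :: "'a topology \<Rightarrow> 'a set \<Rightarrow> bool" where
  "perfect_in X S \<longleftrightarrow> closedin X S \<and> (\<forall>x\<in>S. x \<in> X derived_set_of S)"

text \<open>In the parametrization of the unit sphere by inverse stereographic projection the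
  area element is \<open>4 / (1 + |z|\<^sup>2)\<^sup>2\<close>; dividing by the total area \<open>4 * pi\<close> gives the density
  below. The point at infinity is a null set.\<close>

definition sphere_borel :: "sphere measure" where
  "sphere_borel = sigma UNIV {U. openin sphere_topology U}"

definition sphere_measure :: "sphere measure" where
  "sphere_measure =
     distr (density lborel (\<lambda>z::complex. ennreal (1 / (pi * (1 + (cmod z)\<^sup>2)\<^sup>2)))) sphere_borel Some"

text \<open>A function on \<open>\<Omega>\<close> is represented by its extension by zero to the whole sphere, so that
  equality of functions on \<open>\<Omega>\<close> is equality in HOL. Holomorphy is tested in the two standard
  charts \<open>z\<close> and \<open>1 / z\<close>; the latter is the one that sees the point at infinity.\<close>

definition sphere_holomorphic :: "sphere set \<Rightarrow> (sphere \<Rightarrow> complex) set" where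
  "sphere_holomorphic \<Omega> =
     {f. (\<lambda>z. f (Some z)) holomorphic_on {z. Some z \<in> \<Omega>}
       \<and> (\<lambda>w. f (sphere_inverse (Some w))) holomorphic_on {w. sphere_inverse (Some w) \<in> \<Omega>}
       \<and> (None \<in> \<Omega> \<longrightarrow> f None = 0)
       \<and> (\<forall>x. x \<notin> \<Omega> \<longrightarrow> f x = 0)}"

definition bergman_space :: "real \<Rightarrow> sphere set \<Rightarrow> (sphere \<Rightarrow> complex) set" where
  "bergman_space p \<Omega> =
     {f \<in> sphere_holomorphic \<Omega>. set_integrable sphere_measure \<Omega> (\<lambda>x. cmod (f x) powr p)}"

definition bergman_norm :: "real \<Rightarrow> sphere set \<Rightarrow> (sphere \<Rightarrow> complex) \<Rightarrow> real" where
  "bergman_norm p \<Omega> f = (LINT x:\<Omega>|sphere_measure. cmod (f x) powr p) powr (1 / p)"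

definition bergman_topology :: "real \<Rightarrow> sphere set \<Rightarrow> (sphere \<Rightarrow> complex) topology" where
  "bergman_topology p \<Omega> =
     Metric_space.mtopology (bergman_space p \<Omega>) (\<lambda>f g. bergman_norm p \<Omega> (\<lambda>x. f x - g x))"

definition taylor_shift :: "sphere set \<Rightarrow> (sphere \<Rightarrow> complex) \<Rightarrow> sphere \<Rightarrow> complex" where
  "taylor_shift \<Omega> f x =
     (if x \<notin> \<Omega> then 0
      else case x of
        None \<Rightarrow> 0
      | Some z \<Rightarrow> if z = 0 then deriv (\<lambda>w. f (Some w)) 0 else (f (Some z) - f (Some 0)) / z)"

text \<open>The notion is meant for continuous linear self-maps of the space carrying the topology;
  the Taylor shift on a Bergman space is one, so these properties are not repeated here.\<close>

definition hypercyclic :: "'a topology \<Rightarrow> ('a \<Rightarrow> 'a) \<Rightarrow> bool" where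
  "hypercyclic X T \<longleftrightarrow>
     (\<exists>x \<in> topspace X. X closure_of (range (\<lambda>n. (T ^^ n) x)) = topspace X)"

end

theory Submission
  imports Defs
begin

text \<open>An isolated point of \<open>\<Omega>\<^sup>*\<close> is \<open>1 / a\<close> for an isolated point \<open>a\<close> of the complement of
  \<open>\<Omega>\<close>, possibly \<open>a = \<infinity>\<close>. Since \<open>p \<ge> 1\<close>, integrability forces every \<open>f\<close> in the Bergman space to
  have at most a simple pole at \<open>a\<close>, and since \<open>p < 2\<close>, simple poles do occur. The residue at \<open>a\<close>
  (for \<open>a = \<infinity>\<close>: the coefficient of \<open>z\<close>) is a nonzero continuous functional, and
  \<open>z (T f)(z) = f(z) - f(0)\<close> shows that it is an eigenvector of the adjoint of \<open>T\<close> with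
  eigenvalue \<open>1 / a\<close>. An operator whose adjoint has an eigenvector is not hypercyclic.\<close>

unbundle no fps_syntax

section \<open>The area sub-mean value property\<close>

text \<open>Bounding the order of the pole needs (w - a)^2 f(w) \<rightarrow> 0; a bound of order |w
  - a|^(-2) would still allow a double pole. The limit comes from the area mean value inequality on
  the disc about w of radius |w - a| / 2: its area is comparable to |w - a|^2, while the integral of
  |f|^p over it tends to 0 because the disc lies in a shrinking punctured neighbourhood of a. At
  infinity the disc about z of radius |z| / 2 has area of order |z|^2 and the spherical density
  there is of order |z|^(-4), so the same argument gives f(z) = o(|z|^2), which excludes everything
  beyond a linear term. The mean value inequality also bounds f on compact sets by the norm. This
  yields the definiteness of the norm, and the continuity of the residue, which by the maximum
  principle is controlled by f on one circle around a. Every complex number is the residue of some k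
  / (z - a), or of k z at infinity, whereas the residues along an orbit form a geometric sequence,
  which misses some disc.\<close>

text \<open>Transports Lebesgue measure from \<open>real^2\<close>, where orthogonal transformations
  preserve it; agreement on boxes determines the measure.\<close>

lemma lborel_complex_eq_distr_vec:
  "(lborel :: complex measure) = distr (lborel :: (real^2) measure) borel (\<lambda>v. Complex (v $ 1) (v $ 2))"
proof (rule lborel_eqI)
  let ?\<phi> = "\<lambda>v::real^2. Complex (v $ 1) (v $ 2)"
  have meas: "?\<phi> \<in> borel_measurable borel"
    by (intro borel_measurable_continuous_onI continuous_intros)
  fix l u :: complex assume lu: "\<And>b. b \<in> Basis \<Longrightarrow> l \<bullet> b \<le> u \<bullet> b"
  have le: "Re l \<le> Re u" "Im l \<le> Im u"
    using lu[of 1] lu[of \<i>] by (auto simp: Basis_complex_def)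
  define l' u' :: "real^2" where "l' = vector [Re l, Im l]" and "u' = vector [Re u, Im u]"
  have "?\<phi> -` box l u = box l' u'"
    by (auto simp: l'_def u'_def in_box_complex_iff mem_box_cart forall_2)
  moreover have "emeasure lborel (box l' u') = ennreal (\<Prod>i\<in>UNIV. u' $ i - l' $ i)"
  proof -
    have "l' $ i \<le> u' $ i" for i
      using exhaust_2[of i] le by (auto simp: l'_def u'_def)
    then have "\<And>b. b \<in> Basis \<Longrightarrow> l' \<bullet> b \<le> u' \<bullet> b"
      by (auto simp: Basis_vec_def inner_axis)
    then have "emeasure lborel (box l' u') = ennreal (\<Prod>b\<in>Basis. (u' - l') \<bullet> b)"
      by (simp add: emeasure_lborel_box_eq)
    also have "(\<Prod>b\<in>Basis. (u' - l') \<bullet> b) = (\<Prod>i\<in>UNIV. u' $ i - l' $ i)"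
    proof -
      have "(Basis :: (real^2) set) = (\<lambda>i. axis i 1) ` UNIV"
        by (auto simp: Basis_vec_def)
      moreover have "inj (\<lambda>i::2. axis i (1::real))"
        by (simp add: inj_on_def axis_eq_axis)
      ultimately show ?thesis
        using prod.reindex[of "\<lambda>i::2. axis i (1::real)" UNIV "\<lambda>b. (u' - l') \<bullet> b"]
        by (simp add: inner_axis)
    qed
    finally show ?thesis .
  qed
  moreover have "(\<Prod>i\<in>UNIV. u' $ i - l' $ i) = prod ((\<bullet>) (u - l)) Basis"
    by (simp add: UNIV_2 l'_def u'_def Basis_complex_def)
  ultimately show "emeasure (distr lborel borel ?\<phi>) (box l u) = ennreal (prod ((\<bullet>) (u - l)) Basis)"
    using meas by (subst emeasure_distr) (auto simp: measurable_lborel1)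
qed auto

text \<open>Multiplication by a unimodular number is linear and norm-preserving, so on
  \<open>real^2\<close> it is an orthogonal transformation.\<close>

lemma lborel_complex_rotate:
  assumes "cmod c = 1"
  shows "distr lborel borel (\<lambda>z. c * z) = (lborel :: complex measure)"
proof (rule sym, rule lborel_eqI)
  define \<phi> where "\<phi> = (\<lambda>v::real^2. Complex (v $ 1) (v $ 2))"
  define \<psi> where "\<psi> = (\<lambda>z. vector [Re z, Im z] :: real^2)"
  \<comment> \<open>Division by \<open>c\<close> instead of multiplication: the preimage of a box
    under multiplication by \<open>c\<close> then becomes a direct image under the orthogonal map
    \<open>R\<close>.\<close>
  define R where "R = (\<lambda>v. \<psi> (\<phi> v / c))"
  have c0: "c \<noteq> 0" using assms by auto
  have \<phi>\<psi>: "\<phi> (\<psi> z) = z" and \<psi>\<phi>: "\<psi> (\<phi> v) = v" for z v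
    by (auto simp: \<phi>_def \<psi>_def vec_eq_iff forall_2)
  have meas: "\<phi> \<in> borel_measurable borel"
    unfolding \<phi>_def by (intro borel_measurable_continuous_onI continuous_intros)
  have mult: "(\<lambda>z. c * z) \<in> borel_measurable borel"
    by measurable
  have em: "emeasure lborel X = emeasure lborel (\<phi> -` X)" if "X \<in> sets borel" for X
    using that meas
    by (subst lborel_complex_eq_distr_vec, subst emeasure_distr) (auto simp: \<phi>_def measurable_lborel1)
  have norm\<psi>: "norm (\<psi> z) = cmod z" for z
    by (simp add: \<psi>_def norm_vec_def L2_set_def UNIV_2 cmod_def)
  have norm\<phi>: "cmod (\<phi> v) = norm v" for v
    by (metis norm\<psi> \<psi>\<phi>)
  have "linear \<phi>" "linear \<psi>"
    by (auto intro!: linearI simp: \<phi>_def \<psi>_def vec_eq_iff forall_2 complex_eq_iff)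
  moreover have "linear (\<lambda>z. z / c)"
    by (rule bounded_linear.linear[OF bounded_linear_divide])
  ultimately have "linear (\<psi> \<circ> (\<lambda>z. z / c) \<circ> \<phi>)"
    by (intro linear_compose)
  then have "linear R"
    by (simp add: R_def o_def)
  moreover have "norm (R v) = norm v" for v
    by (simp add: R_def norm\<psi> norm\<phi> norm_divide assms)
  ultimately have R: "orthogonal_transformation R"
    by (simp add: orthogonal_transformation)
  fix l u :: complex assume lu: "\<And>b. b \<in> Basis \<Longrightarrow> l \<bullet> b \<le> u \<bullet> b"
  have "emeasure (distr lborel borel (\<lambda>z. c * z)) (box l u) = emeasure lborel ((\<lambda>z. c * z) -` box l u)"
    using mult by (subst emeasure_distr) (auto simp: measurable_lborel1)
  also have "\<dots> = emeasure lborel (\<phi> -` ((\<lambda>z. c * z) -` box l u))"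
    using measurable_sets[OF mult, of "box l u"] by (intro em) auto
  also have preimage: "\<phi> -` ((\<lambda>z. c * z) -` box l u) = R ` (\<phi> -` box l u)"
  proof (intro equalityI subsetI)
    fix v assume "v \<in> \<phi> -` ((\<lambda>z. c * z) -` box l u)"
    then have "v = R (\<psi> (c * \<phi> v))" "\<psi> (c * \<phi> v) \<in> \<phi> -` box l u"
      using c0 by (simp_all add: R_def \<phi>\<psi> \<psi>\<phi>)
    then show "v \<in> R ` (\<phi> -` box l u)" by blast
  next
    fix v assume "v \<in> R ` (\<phi> -` box l u)"
    then show "v \<in> \<phi> -` ((\<lambda>z. c * z) -` box l u)"
      using c0 by (auto simp: R_def \<phi>\<psi>)
  qed
  also have "emeasure lborel (R ` (\<phi> -` box l u)) = emeasure lborel (\<phi> -` box l u)"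
  proof -
    have S: "\<phi> -` box l u \<in> sets borel"
      using measurable_sets[OF meas, of "box l u"] by simp
    have "emeasure lborel (\<phi> -` box l u) < \<infinity>"
      using em[of "box l u"] emeasure_lborel_box_finite[of l u] by simp
    then have fm: "\<phi> -` box l u \<in> lmeasurable"
      using S by (intro fmeasurableI) auto
    have "R ` (\<phi> -` box l u) \<in> sets borel"
      unfolding preimage[symmetric]
      using measurable_sets[OF meas measurable_sets[OF mult, of "box l u"]] by simp
    moreover have "R ` (\<phi> -` box l u) \<in> lmeasurable"
      using R fm measure_orthogonal_image measurable_orthogonal_image by blast
    moreover have "measure lebesgue (R ` (\<phi> -` box l u)) = measure lebesgue (\<phi> -` box l u)"
      by (rule measure_orthogonal_image[OF R fm])
    ultimately have "emeasure lebesgue (R ` (\<phi> -` box l u)) = emeasure lebesgue (\<phi> -` box l u)"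
      using fm by (simp add: emeasure_eq_measure2)
    then show ?thesis
      using S \<open>R ` (\<phi> -` box l u) \<in> sets borel\<close> by (simp add: emeasure_completion)
  qed
  also have "\<dots> = emeasure lborel (box l u)"
    by (rule em[symmetric]) auto
  also have "\<dots> = ennreal (prod ((\<bullet>) (u - l)) Basis)"
    using lu by (simp add: emeasure_lborel_box_eq)
  finally show "emeasure (distr lborel borel (\<lambda>z. c * z)) (box l u) = ennreal (prod ((\<bullet>) (u - l)) Basis)" .
qed auto
text \<open>Cauchy's formula at the centre of the unit circle, applied to
  \<open>h u = f (z + u * w)\<close>. Moving \<open>w\<close> into the function keeps the circle
  fixed and covers w = 0 as well.\<close>

lemma holomorphic_mean_value:
  assumes f: "f holomorphic_on ball z s" and w: "cmod w < s"
  shows "((\<lambda>t. f (z + cis (2 * pi * t) * w)) has_integral f z) {0..1}"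
proof -
  define h where "h = (\<lambda>u. f (z + u * w))"
  have "(\<lambda>u. z + u * w) ` cball 0 1 \<subseteq> ball z s"
  proof clarify
    fix u :: complex assume "u \<in> cball 0 1"
    then have "cmod u * cmod w \<le> 1 * cmod w" by (intro mult_right_mono) auto
    with w show "z + u * w \<in> ball z s" by (simp add: dist_norm norm_mult)
  qed
  then have "h holomorphic_on cball 0 1"
    unfolding h_def
    by (intro holomorphic_on_compose_gen[OF _ f, unfolded o_def] holomorphic_intros) auto
  then have "((\<lambda>u. h u / (u - 0)) has_contour_integral 2 * pi * \<i> * h 0) (circlepath 0 1)"
    using Cauchy_integral_circlepath_simple[of h 0 1 0] by simp
  then have "((\<lambda>t. 2 * pi * \<i> * h (cis (2 * pi * t))) has_integral 2 * pi * \<i> * h 0) {0..1}"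
    unfolding has_contour_integral
    by (rule has_integral_eq[rotated])
      (simp only: vector_derivative_circlepath, simp add: circlepath cis_conv_exp mult_ac)
  then have "((\<lambda>t. inverse (2 * pi * \<i>) * (2 * pi * \<i> * h (cis (2 * pi * t)))) has_integral
      inverse (2 * pi * \<i>) * (2 * pi * \<i> * h 0)) {0..1}"
    by (rule has_integral_mult_right)
  moreover have "inverse (2 * pi * \<i>) * (2 * pi * \<i> * x) = x" for x :: complex
    by (simp add: field_simps)
  ultimately show ?thesis by (simp only: h_def) simp
qed

text \<open>Averaging over rotations about \<open>z\<close> avoids polar coordinates: only Tonelli and the rotation
  invariance of Lebesgue measure are needed.\<close>

lemma holomorphic_sub_mean_value_ball:
  fixes f :: "complex \<Rightarrow> complex"
  assumes f: "f holomorphic_on ball z s" and s: "s > 0"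
  shows "ennreal (cmod (f z)) * emeasure lborel (ball z s)
    \<le> (\<integral>\<^sup>+u. ennreal (cmod (f u)) * indicator (ball z s) u \<partial>lborel)"
proof -
  \<comment> \<open>Moving the ball to the origin turns rotations about \<open>z\<close> into
    multiplications by \<open>e t\<close>, and these leave the cut-off unchanged.\<close>
  define G where "G = (\<lambda>u. ennreal (cmod (f (z + u))) * indicator (ball 0 s) u)"
  define e where "e = (\<lambda>t. cis (2 * pi * t))"
  have cont: "continuous_on (ball 0 s) (\<lambda>u. f (z + u))"
    using holomorphic_on_imp_continuous_on[OF f]
    by (rule continuous_on_compose2) (auto intro!: continuous_intros simp: dist_norm)
  have e: "continuous_on UNIV e" unfolding e_def by (intro continuous_intros)
  have G_eq: "G = (\<lambda>u. ennreal (cmod (indicator (ball 0 s) u *\<^sub>R f (z + u))))"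
    by (auto simp: G_def fun_eq_iff indicator_def)
  have G [measurable]: "G \<in> borel_measurable borel"
  proof -
    have "(\<lambda>u. indicator (ball 0 s) u *\<^sub>R f (z + u)) \<in> borel_measurable borel"
      using cont by (intro borel_measurable_continuous_on_indicator) auto
    then show ?thesis unfolding G_eq by measurable
  qed
  have e_meas [measurable]: "e \<in> borel_measurable borel"
    using e by (rule borel_measurable_continuous_onI)
  have le: "ennreal (cmod (f z)) \<le> (\<integral>\<^sup>+t. indicator {0..1} t * G (e t * w) \<partial>lborel)"
    if w: "w \<in> ball 0 s" for w
  proof -
    let ?g = "\<lambda>t. f (z + e t * w)"
    have "continuous_on {0..1} ?g"
    proof (rule continuous_on_compose2[OF holomorphic_on_imp_continuous_on[OF f]])
      show "continuous_on {0..1} (\<lambda>t. z + e t * w)"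
        by (intro continuous_intros continuous_on_subset[OF e]) auto
    qed (use w in \<open>auto simp: dist_norm norm_mult e_def\<close>)
    then have int: "set_integrable lborel {0..1} ?g"
      by (rule borel_integrable_atLeastAtMost')
    have "f z = integral {0..1} ?g"
      using holomorphic_mean_value[OF f, of w] w by (simp add: e_def integral_unique)
    also have "\<dots> = (LINT t:{0..1}|lborel. ?g t)"
      using set_borel_integral_eq_integral(2)[OF int] by simp
    finally have "ennreal (cmod (f z)) \<le> (\<integral>\<^sup>+t. ennreal (cmod (indicator {0..1} t *\<^sub>R ?g t)) \<partial>lborel)"
      using integral_norm_bound_ennreal[OF int[unfolded set_integrable_def]]
      by (simp add: set_lebesgue_integral_def)
    also have "\<dots> = (\<integral>\<^sup>+t. indicator {0..1} t * G (e t * w) \<partial>lborel)"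
      using w by (intro nn_integral_cong) (auto simp: G_def indicator_def e_def norm_mult)
    finally show ?thesis .
  qed
  have "emeasure lborel (ball z s) = emeasure lborel (ball (0::complex) s)"
    using s by (simp add: emeasure_ball)
  then have "ennreal (cmod (f z)) * emeasure lborel (ball z s)
      = (\<integral>\<^sup>+w. ennreal (cmod (f z)) * indicator (ball (0::complex) s) w \<partial>lborel)"
    by (simp add: nn_integral_cmult_indicator)
  also have "\<dots> \<le> (\<integral>\<^sup>+w. (\<integral>\<^sup>+t. indicator {0..1} t * G (e t * w) \<partial>lborel) \<partial>lborel)"
    by (intro nn_integral_mono) (use le in \<open>auto simp: indicator_def\<close>)
  also have "\<dots> = (\<integral>\<^sup>+t. (\<integral>\<^sup>+w. indicator {0..1} t * G (e t * w) \<partial>lborel) \<partial>lborel)"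
    by (rule lborel_pair.Fubini') (simp add: split_beta')
  also have "\<dots> = (\<integral>\<^sup>+t. indicator {0..1::real} t * (\<integral>\<^sup>+w. G w \<partial>lborel) \<partial>lborel)"
  proof (intro nn_integral_cong)
    fix t
    have "(\<integral>\<^sup>+w. G w \<partial>lborel) = (\<integral>\<^sup>+w. G w \<partial>distr lborel borel (\<lambda>w. e t * w))"
      by (simp add: lborel_complex_rotate e_def)
    also have "\<dots> = (\<integral>\<^sup>+w. G (e t * w) \<partial>lborel)"
      by (rule nn_integral_distr) auto
    finally show "(\<integral>\<^sup>+w. indicator {0..1} t * G (e t * w) \<partial>lborel)
        = indicator {0..1} t * (\<integral>\<^sup>+w. G w \<partial>lborel)"
      by (simp add: nn_integral_cmult)
  qed
  also have "\<dots> = (\<integral>\<^sup>+w. G w \<partial>lborel)"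
    by (simp add: nn_integral_multc)
  also have "\<dots> = (\<integral>\<^sup>+u. ennreal (cmod (f u)) * indicator (ball z s) u \<partial>lborel)"
  proof -
    have [measurable]: "(\<lambda>u. G (u - z)) \<in> borel_measurable borel"
      by measurable
    have "(\<integral>\<^sup>+u. G (u - z) \<partial>lborel) = (\<integral>\<^sup>+u. G (u - z) \<partial>distr lborel borel ((+) z))"
      by (simp add: lborel_distr_plus)
    also have "\<dots> = (\<integral>\<^sup>+w. G w \<partial>lborel)"
      by (subst nn_integral_distr) auto
    finally show ?thesis
      unfolding G_def by (simp add: indicator_def dist_norm norm_minus_commute)
  qed
  finally show ?thesis .
qed

section \<open>The topology of the sphere\<close>

lemma sphere_inverse_involution [simp]: "sphere_inverse (sphere_inverse x) = x"
  by (cases x) auto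

text \<open>A neighbourhood of infinity is the complement of a compact set, that is, of a bounded
  closed set, and inversion turns the exterior of a large disc into a punctured disc about 0. In
  this two-chart form inversion is visibly a homeomorphism.\<close>

lemma openin_sphere_topology_iff:
  "openin sphere_topology U \<longleftrightarrow>
     open (Some -` U) \<and> open ((\<lambda>w. sphere_inverse (Some w)) -` U)"
    (is "_ \<longleftrightarrow> open ?U \<and> open ?U'")
proof -
  \<comment> \<open>The first chart already controls every w other than 0, so in the second chart
    only w = 0, the image of \<open>None\<close>, calls for a separate argument.\<close>
  have open_punct: "open (?U' - {0})" if "open ?U" for U
  proof -
    have "open (- {0} \<inter> (\<lambda>w. 1 / w) -` ?U)"
      using that by (intro continuous_open_preimage) (auto intro!: continuous_intros)
    also have "- {0} \<inter> (\<lambda>w. 1 / w) -` ?U = ?U' - {0}"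
      by (auto split: if_splits)
    finally show ?thesis .
  qed
  have zero_iff: "0 \<in> ?U' \<longleftrightarrow> None \<in> U" by simp
  show ?thesis
  proof (intro iffI conjI)
    assume "openin sphere_topology U"
    then consider V where "open V" "U = Some ` V"
      | C where "compact C" "U = insert None (Some ` (- C))"
      unfolding sphere_topology_def openin_Alexandroff_compactification
      by (auto simp: Compl_eq_Diff_UNIV)
    then have "open ?U \<and> open ?U'"
    proof cases
      case 1
      then have "?U = V" by auto
      with 1 have o: "open ?U" by simp
      from 1 have "0 \<notin> ?U'" by auto
      then have "?U' - {0} = ?U'" by blast
      with open_punct[OF o] o show ?thesis by simp
    next
      case 2
      then have eq: "?U = - C" by auto
      with 2 have o: "open ?U" by (simp add: compact_imp_closed open_Compl)
      from 2 obtain B where B: "B > 0" "\<And>z. z \<in> C \<Longrightarrow> cmod z \<le> B"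
        using bounded_pos compact_imp_bounded by metis
      have "ball 0 (1 / B) \<subseteq> ?U'"
      proof
        fix w :: complex assume w: "w \<in> ball 0 (1 / B)"
        have "1 / w \<notin> C" if "w \<noteq> 0"
          using B(2)[of "1 / w"] w that B(1) by (auto simp: norm_divide field_simps)
        then show "w \<in> ?U'" using 2 by auto
      qed
      then have "?U' = (?U' - {0}) \<union> ball 0 (1 / B)"
        using B(1) by auto
      moreover have "open ((?U' - {0}) \<union> ball 0 (1 / B))"
        using open_punct[OF o] by blast
      ultimately show ?thesis using o by simp
    qed
    then show "open ?U" "open ?U'" by auto
  next
    assume *: "open ?U \<and> open ?U'"
    show "openin sphere_topology U"
    proof (cases "None \<in> U")
      case False
      then have "U = Some ` ?U" by (auto simp: image_iff) (metis option.exhaust)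
      with * show ?thesis
        unfolding sphere_topology_def openin_Alexandroff_compactification by auto
    next
      case True
      then obtain e where e: "e > 0" "ball 0 e \<subseteq> ?U'"
        using * zero_iff open_contains_ball by (metis vimageI2 zero_iff)
      have "- ?U \<subseteq> cball 0 (1 / e)"
      proof
        fix z assume z: "z \<in> - ?U"
        show "z \<in> cball 0 (1 / e)"
        proof (rule ccontr)
          assume "z \<notin> cball 0 (1 / e)"
          then have "cmod z > 1 / e" by simp
          moreover from this have "z \<noteq> 0" using e(1) by (auto simp: field_simps)
          ultimately have "1 / z \<in> ball 0 e"
            using e(1) by (simp add: norm_divide field_simps)
          then have "sphere_inverse (Some (1 / z)) \<in> U" using e(2) by blast
          then show False using z \<open>z \<noteq> 0\<close> by simp
        qed
      qed
      then have "compact (- ?U)"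
        using * by (meson bounded_cball bounded_subset closed_Compl compact_eq_bounded_closed)
      moreover have "U = insert None (Some ` (UNIV - - ?U))"
        using True by (auto simp: image_iff)
      ultimately show ?thesis
        using * unfolding sphere_topology_def openin_Alexandroff_compactification
        by (intro disjI2 exI[of _ "- ?U"]) (auto simp: closed_Compl)
    qed
  qed
qed

lemma topspace_sphere_topology [simp]: "topspace sphere_topology = UNIV"
  by (auto simp: sphere_topology_def topspace_Alexandroff_compactification UNIV_option_conv)

lemma openin_sphere_inverse_vimage:
  assumes "openin sphere_topology U"
  shows "openin sphere_topology (sphere_inverse -` U)"
proof -
  have "Some -` (sphere_inverse -` U) = (\<lambda>w. sphere_inverse (Some w)) -` U"
    and "(\<lambda>w. sphere_inverse (Some w)) -` (sphere_inverse -` U) = Some -` U"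
    by (auto simp del: sphere_inverse.simps)
  with assms show ?thesis
    unfolding openin_sphere_topology_iff by simp
qed

lemma sphere_star_eq: "sphere_star A = sphere_inverse -` (- A)"
    unfolding sphere_star_def
proof (intro equalityI subsetI)
  fix x assume "x \<in> sphere_inverse -` (- A)"
  then show "x \<in> sphere_inverse ` (- A)"
    by (intro image_eqI[of _ _ "sphere_inverse x"]) auto
qed auto

lemma closedin_sphere_star:
  assumes "openin sphere_topology U"
  shows "closedin sphere_topology (sphere_star U)"
  using openin_sphere_inverse_vimage[OF assms]
  by (simp add: closedin_def sphere_star_eq vimage_Compl flip: Compl_eq_Diff_UNIV)

text \<open>Inversion carries a neighbourhood isolating \<open>x\<close> in the star to one
  isolating \<open>sphere_inverse x\<close> in the complement of \<open>U\<close>. The case x = Some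
  0 is read in the chart 1 / z, so both cases end with a punctured disc.\<close>

lemma sphere_isolated_point_cases:
  assumes U: "openin sphere_topology U" and x: "x \<in> sphere_star U" "x \<notin> sphere_topology derived_set_of (sphere_star U)"
  obtains (finite) a \<rho> where "\<rho> > 0" "Some a \<notin> U" "\<And>z. z \<in> ball a \<rho> - {a} \<Longrightarrow> Some z \<in> U"
    | (infinite) \<rho> where "\<rho> > 0" "None \<notin> U" "\<And>w. w \<in> ball 0 \<rho> - {0} \<Longrightarrow> Some (1 / w) \<in> U"
proof -
  from x obtain N where N: "openin sphere_topology N" "x \<in> N"
    "\<And>y. y \<noteq> x \<Longrightarrow> y \<in> sphere_star U \<Longrightarrow> y \<notin> N"
    by (auto simp: in_derived_set_of)
  define M where "M = sphere_inverse -` N"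
  have M: "openin sphere_topology M" "sphere_inverse x \<in> M"
    using N openin_sphere_inverse_vimage by (auto simp: M_def)
  have xU: "sphere_inverse x \<notin> U" using x(1) by (simp add: sphere_star_eq)
  have MU: "y \<in> U" if "y \<in> M" "y \<noteq> sphere_inverse x" for y
    using N(3)[of "sphere_inverse y"] that sphere_inverse_involution[of y]
    by (cases "sphere_inverse y = x") (auto simp: sphere_star_eq M_def simp del: sphere_inverse_involution)
  show thesis
  proof (cases "sphere_inverse x")
    case (Some a)
    have "open (Some -` M)" "a \<in> Some -` M"
      using M Some by (auto simp: openin_sphere_topology_iff)
    then obtain \<rho> where "\<rho> > 0" "ball a \<rho> \<subseteq> Some -` M"
      using open_contains_ball by metis
    then have "Some z \<in> U" if "z \<in> ball a \<rho> - {a}" for z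
      using MU[of "Some z"] Some that by auto
    then show thesis using that(1)[of \<rho> a] xU Some \<open>\<rho> > 0\<close> by auto
  next
    case None
    have "open ((\<lambda>w. sphere_inverse (Some w)) -` M)" "0 \<in> (\<lambda>w. sphere_inverse (Some w)) -` M"
      using M None by (auto simp: openin_sphere_topology_iff)
    then obtain \<rho> where \<rho>: "\<rho> > 0" "ball 0 \<rho> \<subseteq> (\<lambda>w. sphere_inverse (Some w)) -` M"
      using open_contains_ball by metis
    have "Some (1 / w) \<in> U" if "w \<in> ball 0 \<rho> - {0}" for w
      using \<rho>(2) that MU[of "Some (1 / w)"] None by auto
    then show thesis using that(2)[of \<rho>] xU None \<rho>(1) by auto
  qed
qed

section \<open>Bergman spaces as normed spaces\<close>

lemma sets_sphere_borel_openin: "openin sphere_topology U \<Longrightarrow> U \<in> sets sphere_borel"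
  by (auto simp: sphere_borel_def)

lemma space_sphere_borel [simp]: "space sphere_borel = UNIV"
  by (simp add: sphere_borel_def)

lemma openin_sphere_Some_image: "open U \<Longrightarrow> openin sphere_topology (Some ` U)"
  unfolding sphere_topology_def openin_Alexandroff_compactification by auto

lemma measurable_Some_sphere_borel: "Some \<in> borel \<rightarrow>\<^sub>M sphere_borel"
  unfolding sphere_borel_def
proof (rule measurable_measure_of)
  show "Some -` U \<inter> space borel \<in> sets borel" if "U \<in> {U. openin sphere_topology U}" for U
  proof -
    have "open (Some -` U)"
      using that unfolding openin_sphere_topology_iff by blast
    then show ?thesis by simp
  qed
qed auto

text \<open>\<open>Some\<close> is an open embedding, so generators go to generators; complements
  are taken relative to the open set of finite points.\<close>

lemma Some_image_sets_sphere_borel: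
  assumes "A \<in> sets borel"
  shows "Some ` A \<in> sets sphere_borel"
proof -
  have "A \<in> sigma_sets UNIV {S. open S}"
    using assms by (simp add: borel_def)
  then show ?thesis
  proof induction
    case (Basic a)
    then show ?case by (auto intro: sets_sphere_borel_openin openin_sphere_Some_image)
  next
    case (Compl a)
    have "Some ` (UNIV - a) = Some ` UNIV - Some ` a" by auto
    moreover have "Some ` (UNIV :: complex set) \<in> sets sphere_borel"
      by (intro sets_sphere_borel_openin openin_sphere_Some_image) auto
    ultimately show ?case using Compl by auto
  next
    case (Union a)
    then have "(\<Union>i. Some ` a i) \<in> sets sphere_borel" by (intro sets.countable_UN) auto
    then show ?case by (simp add: image_UN)
  qed auto
qed

text \<open>The sphere adds to the plane only the measurable singleton
  \<open>{None}\<close>.\<close>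

lemma borel_measurable_sphere_borelI:
  fixes g :: "sphere \<Rightarrow> 'a::topological_space"
  assumes "(\<lambda>z. g (Some z)) \<in> borel_measurable borel"
  shows "g \<in> borel_measurable sphere_borel"
proof (rule measurableI)
  fix A :: "'a set" assume "A \<in> sets borel"
  then have "Some ` ((\<lambda>z. g (Some z)) -` A) \<in> sets sphere_borel"
    using measurable_sets[OF assms] by (intro Some_image_sets_sphere_borel) simp
  moreover have "(if g None \<in> A then {None} else {}) \<in> sets sphere_borel"
  proof -
    have "UNIV - Some ` UNIV \<in> sets sphere_borel"
      using sets.compl_sets[OF Some_image_sets_sphere_borel[of UNIV]] by simp
    moreover have "UNIV - Some ` UNIV = {None :: sphere}"
      by (auto simp: image_iff)
    ultimately show ?thesis by simp
  qed
  moreover have "g -` A \<inter> space sphere_borel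
      = Some ` ((\<lambda>z. g (Some z)) -` A) \<union> (if g None \<in> A then {None} else {})"
  proof (intro set_eqI)
    fix x show "x \<in> g -` A \<inter> space sphere_borel
        \<longleftrightarrow> x \<in> Some ` ((\<lambda>z. g (Some z)) -` A) \<union> (if g None \<in> A then {None} else {})"
      by (cases x) auto
  qed
  ultimately show "g -` A \<inter> space sphere_borel \<in> sets sphere_borel"
    by (simp only: sets.Un)
qed auto

section \<open>Integrals against the spherical area measure\<close>

definition sphere_density :: "complex \<Rightarrow> real" where
  "sphere_density z = 1 / (pi * (1 + (cmod z)\<^sup>2)\<^sup>2)"

lemma sphere_density_pos: "sphere_density z > 0"
  unfolding sphere_density_def
  by (intro divide_pos_pos mult_pos_pos zero_less_power) (auto intro: add_pos_nonneg)

lemma sphere_density_mono: "cmod z \<le> cmod w \<Longrightarrow> sphere_density w \<le> sphere_density z"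
  unfolding sphere_density_def
  by (intro divide_left_mono mult_left_mono power_mono add_left_mono mult_pos_pos zero_less_power)
    (auto intro: add_pos_nonneg)

lemma sphere_density_measurable [measurable]: "sphere_density \<in> borel_measurable borel"
  unfolding sphere_density_def by measurable

lemma nn_integral_sphere_measure:
  assumes [measurable]: "(\<lambda>z. g (Some z)) \<in> borel_measurable borel"
  shows "(\<integral>\<^sup>+x. g x \<partial>sphere_measure) = (\<integral>\<^sup>+z. g (Some z) * ennreal (sphere_density z) \<partial>lborel)"
proof -
  have "(\<integral>\<^sup>+x. g x \<partial>sphere_measure)
      = (\<integral>\<^sup>+z. g (Some z) \<partial>density lborel (\<lambda>z. ennreal (sphere_density z)))"
    unfolding sphere_measure_def sphere_density_def
    using borel_measurable_sphere_borelI[OF assms] measurable_Some_sphere_borel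
    by (intro nn_integral_distr) auto
  also have "\<dots> = (\<integral>\<^sup>+z. ennreal (sphere_density z) * g (Some z) \<partial>lborel)"
    by (intro nn_integral_density) auto
  finally show ?thesis by (simp add: mult.commute)
qed

text \<open>The \<open>p\<close>-th power of the Bergman norm, without truncation at infinite values.\<close>

definition bergman_energy :: "real \<Rightarrow> (sphere \<Rightarrow> complex) \<Rightarrow> ennreal" where
  "bergman_energy p f = (\<integral>\<^sup>+z. ennreal (cmod (f (Some z)) powr p * sphere_density z) \<partial>lborel)"

lemma open_Some_vimage: "openin sphere_topology \<Omega> \<Longrightarrow> open {z. Some z \<in> \<Omega>}"
  by (simp add: openin_sphere_topology_iff vimage_def)

lemma sphere_holomorphic_measurable:
  assumes \<Omega>: "openin sphere_topology \<Omega>" and f: "f \<in> sphere_holomorphic \<Omega>"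
  shows "(\<lambda>z. f (Some z)) \<in> borel_measurable borel"
proof -
  let ?V = "{z. Some z \<in> \<Omega>}"
  have "(\<lambda>z. indicator ?V z *\<^sub>R f (Some z)) \<in> borel_measurable borel"
    using f open_Some_vimage[OF \<Omega>]
    by (intro borel_measurable_continuous_on_indicator)
       (auto simp: sphere_holomorphic_def holomorphic_on_imp_continuous_on)
  moreover have "(\<lambda>z. indicator ?V z *\<^sub>R f (Some z)) = (\<lambda>z. f (Some z))"
    using f by (auto simp: sphere_holomorphic_def indicator_def)
  ultimately show ?thesis by simp
qed

context
  fixes \<Omega> :: "sphere set" and p :: real
  assumes \<Omega>: "openin sphere_topology \<Omega>" 
begin

text \<open>Extension by zero makes the indicator of \<Omega> redundant, and the measure is carried
  by the finite plane; all later estimates can therefore be made for Lebesgue integrals over the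
  plane.\<close>

lemma sphere_holomorphic_powr:
  assumes f: "f \<in> sphere_holomorphic \<Omega>"
  shows "(\<lambda>x. indicator \<Omega> x *\<^sub>R cmod (f x) powr p) = (\<lambda>x. cmod (f x) powr p)" (is ?eq)
    and "(\<lambda>x. cmod (f x) powr p) \<in> borel_measurable sphere_measure" (is ?meas)
    and "(\<integral>\<^sup>+x. ennreal (cmod (f x) powr p) \<partial>sphere_measure) = bergman_energy p f" (is ?int)
proof -
  note [measurable] = sphere_holomorphic_measurable[OF \<Omega> f]
  show ?eq
    using f by (auto simp: sphere_holomorphic_def indicator_def fun_eq_iff)
  have "(\<lambda>x. cmod (f x) powr p) \<in> borel_measurable sphere_borel"
    by (rule borel_measurable_sphere_borelI) measurable
  then show ?meas
    by (simp add: sphere_measure_def measurable_distr_eq1)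
  show ?int
    unfolding bergman_energy_def
    by (subst nn_integral_sphere_measure)
      (auto intro!: nn_integral_cong simp: ennreal_mult sphere_density_pos less_imp_le)
qed

lemma bergman_space_iff:
  "f \<in> bergman_space p \<Omega> \<longleftrightarrow> f \<in> sphere_holomorphic \<Omega> \<and> bergman_energy p f < \<infinity>"
proof -
  have "set_integrable sphere_measure \<Omega> (\<lambda>x. cmod (f x) powr p) \<longleftrightarrow> bergman_energy p f < \<infinity>"
    if "f \<in> sphere_holomorphic \<Omega>"
    unfolding set_integrable_def sphere_holomorphic_powr(1)[OF that]
    using sphere_holomorphic_powr(2,3)[OF that] by (simp add: integrable_iff_bounded)
  then show ?thesis by (auto simp: bergman_space_def)
qed

lemma bergman_norm_eq:
  assumes "f \<in> sphere_holomorphic \<Omega>"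
  shows "bergman_norm p \<Omega> f = enn2real (bergman_energy p f) powr (1 / p)"
  unfolding bergman_norm_def set_lebesgue_integral_def sphere_holomorphic_powr(1)[OF assms]
  by (subst integral_eq_nn_integral[OF sphere_holomorphic_powr(2)[OF assms]])
    (auto simp: sphere_holomorphic_powr(3)[OF assms])

lemma bergman_energy_eq_norm:
  assumes "f \<in> bergman_space p \<Omega>" "p > 0"
  shows "bergman_energy p f = ennreal (bergman_norm p \<Omega> f powr p)"
proof -
  have "f \<in> sphere_holomorphic \<Omega>" "bergman_energy p f < \<infinity>"
    using assms(1) by (simp_all add: bergman_space_iff)
  then show ?thesis using assms(2) by (simp add: bergman_norm_eq powr_powr)
qed

end

section \<open>Minkowski's inequality\<close>

lemma sphere_holomorphic_add:
  "f \<in> sphere_holomorphic \<Omega> \<Longrightarrow> g \<in> sphere_holomorphic \<Omega> \<Longrightarrow> (\<lambda>x. f x + g x) \<in> sphere_holomorphic \<Omega>"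
  by (auto simp: sphere_holomorphic_def intro!: holomorphic_intros)

text \<open>For positive arguments this is convexity of the power; if an argument is 0, it reduces
  to s powr p \<le> s for 0 < s < 1.\<close>

lemma powr_convex_combination:
  fixes x y t p :: real
  assumes p: "p \<ge> 1" and xy: "x \<ge> 0" "y \<ge> 0" and t: "0 < t" "t < 1"
  shows "((1 - t) * x + t * y) powr p \<le> (1 - t) * x powr p + t * y powr p"
proof -
  have small: "(s * u) powr p \<le> s * u powr p" if "0 < s" "s < 1" "u \<ge> 0" for s u :: real
  proof -
    have "s powr p \<le> s powr 1" using that p by (intro powr_mono') auto
    then show ?thesis using that by (simp add: powr_mult mult_right_mono)
  qed
  consider "x = 0" | "y = 0" | "x > 0" "y > 0" using xy by linarith
  then show ?thesis
  proof cases
    case 1 then show ?thesis using small[of t y] t xy by simp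
  next
    case 2 then show ?thesis using small[of "1 - t" x] t xy by simp
  next
    case 3
    then show ?thesis
      using convex_onD[OF powr_convex[OF p], of t x y] t by simp
  qed
qed

text \<open>|u| + |v| is the convex combination of |u| / (1 - t) and |v| / t with weights 1 - t and
  t; convexity of the power and integration give the estimate. The weight stays free, to be
  optimised in Minkowski's inequality.\<close>

lemma bergman_energy_add_le:
  assumes \<Omega>: "openin sphere_topology \<Omega>" and p: "p \<ge> 1" and t: "0 < t" "t < 1"
    and f: "f \<in> sphere_holomorphic \<Omega>" and g: "g \<in> sphere_holomorphic \<Omega>"
  shows "bergman_energy p (\<lambda>x. f x + g x)
    \<le> ennreal ((1 - t) powr (1 - p)) * bergman_energy p f + ennreal (t powr (1 - p)) * bergman_energy p g"
proof -
  note [measurable] = sphere_holomorphic_measurable[OF \<Omega> f] sphere_holomorphic_measurable[OF \<Omega> g]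
  let ?d = sphere_density
  have pt: "cmod (u + v) powr p \<le> (1 - t) powr (1 - p) * cmod u powr p + t powr (1 - p) * cmod v powr p"
    for u v
  proof -
    have scale: "s * (x / s) powr p = s powr (1 - p) * x powr p" if "s > 0" "x \<ge> 0" for s x :: real
      using that by (simp add: powr_divide powr_diff)
    have "cmod (u + v) powr p \<le> ((1 - t) * (cmod u / (1 - t)) + t * (cmod v / t)) powr p"
      using t p norm_triangle_ineq[of u v] by (intro powr_mono2) auto
    also have "\<dots> \<le> (1 - t) * (cmod u / (1 - t)) powr p + t * (cmod v / t) powr p"
      using t p by (intro powr_convex_combination) auto
    finally show ?thesis using t scale[of "1 - t" "cmod u"] scale[of t "cmod v"] by simp
  qed
  have "bergman_energy p (\<lambda>x. f x + g x)
      \<le> (\<integral>\<^sup>+z. ennreal ((1 - t) powr (1 - p)) * ennreal (cmod (f (Some z)) powr p * ?d z)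
          + ennreal (t powr (1 - p)) * ennreal (cmod (g (Some z)) powr p * ?d z) \<partial>lborel)"
    unfolding bergman_energy_def
  proof (rule nn_integral_mono)
    fix z
    have "cmod (f (Some z) + g (Some z)) powr p * ?d z
        \<le> ((1 - t) powr (1 - p) * cmod (f (Some z)) powr p + t powr (1 - p) * cmod (g (Some z)) powr p) * ?d z"
      by (intro mult_right_mono pt) (simp add: sphere_density_pos less_imp_le)
    also have "\<dots> = (1 - t) powr (1 - p) * (cmod (f (Some z)) powr p * ?d z)
        + t powr (1 - p) * (cmod (g (Some z)) powr p * ?d z)"
      by (simp add: algebra_simps)
    finally have "ennreal (cmod (f (Some z) + g (Some z)) powr p * ?d z)
        \<le> ennreal ((1 - t) powr (1 - p) * (cmod (f (Some z)) powr p * ?d z)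
        + t powr (1 - p) * (cmod (g (Some z)) powr p * ?d z))"
      by (rule ennreal_leI)
    also have "\<dots> = ennreal ((1 - t) powr (1 - p)) * ennreal (cmod (f (Some z)) powr p * ?d z)
          + ennreal (t powr (1 - p)) * ennreal (cmod (g (Some z)) powr p * ?d z)"
      using sphere_density_pos[of z] by (simp add: ennreal_mult'' ennreal_plus)
    finally show "ennreal (cmod (f (Some z) + g (Some z)) powr p * ?d z) \<le> \<dots>" .
  qed
  also have "\<dots> = ennreal ((1 - t) powr (1 - p)) * bergman_energy p f
      + ennreal (t powr (1 - p)) * bergman_energy p g"
    unfolding bergman_energy_def
    by (simp add: nn_integral_add nn_integral_cmult)
  finally show ?thesis .
qed

lemma bergman_norm_nonneg: "bergman_norm p \<Omega> f \<ge> 0"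
  by (simp add: bergman_norm_def)

text \<open>The weighted energy estimate is optimised over \<open>t\<close>. Working with numbers
  \<alpha>, \<beta> strictly above the two norms keeps both positive, so that a vanishing norm needs
  no special treatment; the excess is then let tend to 0.\<close>

lemma bergman_minkowski:
  assumes \<Omega>: "openin sphere_topology \<Omega>" and p: "p \<ge> 1"
    and f: "f \<in> bergman_space p \<Omega>" and g: "g \<in> bergman_space p \<Omega>"
  shows "(\<lambda>x. f x + g x) \<in> bergman_space p \<Omega>"
    and "bergman_norm p \<Omega> (\<lambda>x. f x + g x) \<le> bergman_norm p \<Omega> f + bergman_norm p \<Omega> g"
proof -
  let ?h = "\<lambda>x. f x + g x"
  have hol: "f \<in> sphere_holomorphic \<Omega>" "g \<in> sphere_holomorphic \<Omega>"
    using f g \<Omega> by (simp_all add: bergman_space_iff)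
  then have hol_h: "?h \<in> sphere_holomorphic \<Omega>" by (rule sphere_holomorphic_add)
  have le: "bergman_energy p ?h \<le> ennreal ((\<alpha> + \<beta>) powr p)"
    if \<alpha>: "bergman_norm p \<Omega> f < \<alpha>" and \<beta>: "bergman_norm p \<Omega> g < \<beta>" for \<alpha> \<beta>
  proof -
    have pos: "\<alpha> > 0" "\<beta> > 0"
      using that bergman_norm_nonneg[of p \<Omega> f] bergman_norm_nonneg[of p \<Omega> g] by linarith+
    \<comment> \<open>The optimal weight: it collapses the two terms exactly to (\<alpha> + \<beta>)
      powr p.\<close>
    define t where "t = \<beta> / (\<alpha> + \<beta>)"
    have t: "0 < t" "t < 1" "1 - t = \<alpha> / (\<alpha> + \<beta>)"
      using pos by (auto simp: t_def field_simps)
    have E: "bergman_energy p f \<le> ennreal (\<alpha> powr p)" "bergman_energy p g \<le> ennreal (\<beta> powr p)"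
      using \<alpha> \<beta> p bergman_norm_nonneg
      by (auto simp: bergman_energy_eq_norm[OF \<Omega> f] bergman_energy_eq_norm[OF \<Omega> g]
          intro!: ennreal_leI powr_mono2)
    have "bergman_energy p ?h \<le> ennreal ((1 - t) powr (1 - p)) * ennreal (\<alpha> powr p)
        + ennreal (t powr (1 - p)) * ennreal (\<beta> powr p)"
      by (rule order_trans[OF bergman_energy_add_le[OF \<Omega> p t(1,2) hol]])
        (intro add_mono mult_left_mono E; simp)
    also have "\<dots> = ennreal ((1 - t) powr (1 - p) * \<alpha> powr p + t powr (1 - p) * \<beta> powr p)"
      by (simp add: ennreal_mult)
    also have "(1 - t) powr (1 - p) * \<alpha> powr p + t powr (1 - p) * \<beta> powr p = (\<alpha> + \<beta>) powr p"
    proof -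
      have "(x / (\<alpha> + \<beta>)) powr (1 - p) * x powr p = x * (\<alpha> + \<beta>) powr (p - 1)" if "x > 0" for x
        using that pos by (simp add: powr_divide powr_diff)
      then have "(1 - t) powr (1 - p) * \<alpha> powr p + t powr (1 - p) * \<beta> powr p
          = (\<alpha> + \<beta>) * (\<alpha> + \<beta>) powr (p - 1)"
        unfolding t(3) using pos by (simp add: t_def distrib_right)
      also have "\<dots> = (\<alpha> + \<beta>) powr p" using pos by (simp add: powr_diff)
      finally show ?thesis .
    qed
    finally show ?thesis .
  qed
  show h: "?h \<in> bergman_space p \<Omega>"
    using le[of "bergman_norm p \<Omega> f + 1" "bergman_norm p \<Omega> g + 1"] hol_h
    by (auto simp: bergman_space_iff[OF \<Omega>] intro: le_less_trans)
  show "bergman_norm p \<Omega> ?h \<le> bergman_norm p \<Omega> f + bergman_norm p \<Omega> g"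
  proof (rule field_le_epsilon)
    fix e :: real assume e: "e > 0"
    let ?s = "bergman_norm p \<Omega> f + bergman_norm p \<Omega> g + e"
    have "bergman_energy p ?h \<le> ennreal (?s powr p)"
      using le[of "bergman_norm p \<Omega> f + e / 2" "bergman_norm p \<Omega> g + e / 2"] e
      by (simp add: algebra_simps)
    then have "bergman_norm p \<Omega> ?h powr p \<le> ?s powr p"
      using p by (simp add: bergman_energy_eq_norm[OF \<Omega> h])
    moreover have "?s > 0"
      using e bergman_norm_nonneg[of p \<Omega> f] bergman_norm_nonneg[of p \<Omega> g] by linarith
    ultimately show "bergman_norm p \<Omega> ?h \<le> ?s"
      using p powr_less_mono2[of p ?s "bergman_norm p \<Omega> ?h"] by linarith
  qed
qed

lemma bergman_uminus:
  assumes "f \<in> bergman_space p \<Omega>"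
  shows "(\<lambda>x. - f x) \<in> bergman_space p \<Omega>"
  using assms by (auto simp: bergman_space_def sphere_holomorphic_def intro!: holomorphic_intros)

lemma bergman_diff:
  assumes \<Omega>: "openin sphere_topology \<Omega>" and p: "p \<ge> 1"
    and f: "f \<in> bergman_space p \<Omega>" and g: "g \<in> bergman_space p \<Omega>"
  shows "(\<lambda>x. f x - g x) \<in> bergman_space p \<Omega>"
  using bergman_minkowski(1)[OF \<Omega> p f bergman_uminus[OF g]] by simp

text \<open>In place of Hoelder's inequality, \<open>t \<le> \<delta> + \<delta> powr (1 - p) * t powr p\<close> for \<open>t \<ge> 0\<close>
  passes from the mean of \<open>|f|\<close> to that of \<open>|f|\<^sup>p\<close>.\<close>

lemma bergman_pointwise_bound:
  assumes \<Omega>: "openin sphere_topology \<Omega>" and p: "p \<ge> 1" and f: "f \<in> sphere_holomorphic \<Omega>"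
    and s: "s > 0" "\<And>w. w \<in> ball z s \<Longrightarrow> Some w \<in> \<Omega>"
    and D: "D > 0" "\<And>w. w \<in> ball z s \<Longrightarrow> D \<le> sphere_density w"
    and \<nu>: "(\<integral>\<^sup>+w. ennreal (cmod (f (Some w)) powr p * sphere_density w) * indicator (ball z s) w \<partial>lborel)
      \<le> ennreal \<nu>" "\<nu> \<ge> 0"
    and \<delta>: "\<delta> > 0"
  shows "cmod (f (Some z)) \<le> \<delta> + \<delta> powr (1 - p) * \<nu> / (pi * s\<^sup>2 * D)"
proof -
  note [measurable] = sphere_holomorphic_measurable[OF \<Omega> f]
  let ?I = "indicator (ball z s) :: complex \<Rightarrow> ennreal"
  have [measurable]: "?I \<in> borel_measurable borel"
    by (intro borel_measurable_indicator) auto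
  let ?e = "\<lambda>w. ennreal (cmod (f (Some w)) powr p * sphere_density w) * ?I w"
  have vol: "emeasure lborel (ball z s) = ennreal (pi * s\<^sup>2)"
    using s(1) by (simp add: emeasure_ball unit_ball_vol_2)
  have pt: "cmod (f (Some w)) \<le> \<delta> + \<delta> powr (1 - p) / D * (cmod (f (Some w)) powr p * sphere_density w)"
    if "w \<in> ball z s" for w
  proof (cases "cmod (f (Some w)) \<le> \<delta>")
    case True
    have "0 \<le> \<delta> powr (1 - p) / D * (cmod (f (Some w)) powr p * sphere_density w)"
      using D(1) sphere_density_pos[of w] by simp
    with True show ?thesis by linarith
  next
    case False
    let ?x = "cmod (f (Some w))"
    have "?x = ?x powr (1 - p) * ?x powr p"
      using False \<delta> by (simp flip: powr_add)
    \<comment> \<open>Since 1 - p \<le> 0, the power with this exponent is decreasing, and |f|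
      exceeds \<delta> here.\<close>
    also have "\<dots> \<le> \<delta> powr (1 - p) * ?x powr p"
      using False \<delta> p by (intro mult_right_mono powr_mono2') auto
    also have "\<dots> = \<delta> powr (1 - p) * ?x powr p * 1" by simp
    also have "\<dots> \<le> \<delta> powr (1 - p) * ?x powr p * (sphere_density w / D)"
      using D that by (intro mult_left_mono) auto
    finally show ?thesis using \<delta> by (simp add: mult_ac)
  qed
  have hol: "(\<lambda>w. f (Some w)) holomorphic_on ball z s"
    using f s(2) by (auto simp: sphere_holomorphic_def intro: holomorphic_on_subset)
  have "ennreal (cmod (f (Some z)) * (pi * s\<^sup>2)) = ennreal (cmod (f (Some z))) * emeasure lborel (ball z s)"
    by (simp add: vol ennreal_mult)
  also have "\<dots> \<le> (\<integral>\<^sup>+w. ennreal (cmod (f (Some w))) * ?I w \<partial>lborel)"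
    by (rule holomorphic_sub_mean_value_ball[OF hol s(1)])
  also have "\<dots> \<le> (\<integral>\<^sup>+w. ennreal \<delta> * ?I w + ennreal (\<delta> powr (1 - p) / D) * ?e w \<partial>lborel)"
  proof (rule nn_integral_mono)
    fix w
    have "ennreal (cmod (f (Some w))) \<le> ennreal \<delta> + ennreal (\<delta> powr (1 - p) / D)
        * ennreal (cmod (f (Some w)) powr p * sphere_density w)" if "w \<in> ball z s"
    proof -
      let ?c = "\<delta> powr (1 - p) / D" and ?x = "cmod (f (Some w)) powr p * sphere_density w"
      have nn: "?c \<ge> 0" "?x \<ge> 0" using D(1) sphere_density_pos[of w] by simp_all
      have "ennreal (cmod (f (Some w))) \<le> ennreal (\<delta> + ?c * ?x)"
        by (rule ennreal_leI[OF pt[OF that]])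
      also have "\<dots> = ennreal \<delta> + ennreal (?c * ?x)"
        by (rule ennreal_plus[OF less_imp_le[OF \<delta>] mult_nonneg_nonneg[OF nn]])
      also have "ennreal (?c * ?x) = ennreal ?c * ennreal ?x"
        using nn by (rule ennreal_mult)
      finally show ?thesis .
    qed
    then show "ennreal (cmod (f (Some w))) * ?I w \<le> ennreal \<delta> * ?I w + ennreal (\<delta> powr (1 - p) / D) * ?e w"
      by (cases "w \<in> ball z s") auto
  qed
  also have "\<dots> = ennreal \<delta> * ennreal (pi * s\<^sup>2) + ennreal (\<delta> powr (1 - p) / D) * (\<integral>\<^sup>+w. ?e w \<partial>lborel)"
    by (simp add: nn_integral_add nn_integral_cmult vol)
  also have "\<dots> \<le> ennreal \<delta> * ennreal (pi * s\<^sup>2) + ennreal (\<delta> powr (1 - p) / D) * ennreal \<nu>"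
    by (intro add_left_mono mult_left_mono \<nu>) simp
  also have "\<dots> = ennreal (\<delta> * (pi * s\<^sup>2) + \<delta> powr (1 - p) / D * \<nu>)"
  proof -
    have "ennreal \<delta> * ennreal (pi * s\<^sup>2) = ennreal (\<delta> * (pi * s\<^sup>2))"
      using \<delta> by (intro ennreal_mult[symmetric]) auto
    moreover have "ennreal (\<delta> powr (1 - p) / D) * ennreal \<nu> = ennreal (\<delta> powr (1 - p) / D * \<nu>)"
      using D(1) \<nu>(2) by (intro ennreal_mult[symmetric]) auto
    ultimately show ?thesis
      using \<delta> D(1) \<nu>(2) by (simp add: ennreal_plus del: ennreal_mult')
  qed
  finally have "cmod (f (Some z)) * (pi * s\<^sup>2) \<le> \<delta> * (pi * s\<^sup>2) + \<delta> powr (1 - p) / D * \<nu>"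
    using \<delta> D(1) \<nu>(2) by (subst (asm) ennreal_le_iff) auto
  moreover have V: "pi * s\<^sup>2 > 0" using s(1) by simp
  ultimately have "cmod (f (Some z)) \<le> (\<delta> * (pi * s\<^sup>2) + \<delta> powr (1 - p) / D * \<nu>) / (pi * s\<^sup>2)"
    by (simp only: pos_le_divide_eq)
  also have "\<dots> = \<delta> + \<delta> powr (1 - p) * \<nu> / (pi * s\<^sup>2 * D)"
    using s(1) by (simp add: add_divide_distrib mult_ac)
  finally show ?thesis .
qed

text \<open>By compactness one radius \<open>s\<close> serves all points of \<open>K\<close>, and
  the density is bounded below on the resulting bounded union of discs; the pointwise bound is then
  uniform over \<open>K\<close>.\<close>

lemma bergman_evaluation_equicontinuous:
  assumes \<Omega>: "openin sphere_topology \<Omega>" and p: "p \<ge> 1"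
    and K: "compact K" "\<And>z. z \<in> K \<Longrightarrow> Some z \<in> \<Omega>" and \<epsilon>: "\<epsilon> > 0"
  obtains \<delta> where "\<delta> > 0"
    "\<And>f z. f \<in> bergman_space p \<Omega> \<Longrightarrow> bergman_norm p \<Omega> f < \<delta> \<Longrightarrow> z \<in> K \<Longrightarrow> cmod (f (Some z)) \<le> \<epsilon>"
proof -
  have "K \<subseteq> {z. Some z \<in> \<Omega>}" using K by auto
  then obtain s where s: "s > 0" "(\<Union>x\<in>K. ball x s) \<subseteq> {z. Some z \<in> \<Omega>}"
    using compact_subset_open_imp_ball_epsilon_subset[OF K(1) open_Some_vimage[OF \<Omega>]] by metis
  obtain B where B: "B > 0" "\<And>z. z \<in> K \<Longrightarrow> cmod z \<le> B"
    using compact_imp_bounded[OF K(1)] bounded_pos by metis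
  \<comment> \<open>The density decreases with the modulus, and B + s bounds the modulus on all
    discs.\<close>
  define D where "D = sphere_density (complex_of_real (B + s))"
  have D: "D > 0" by (simp add: D_def sphere_density_pos)
  define C where "C = pi * s\<^sup>2 * D"
  have C: "C > 0" using s(1) D by (simp add: C_def)
  \<comment> \<open>\<delta> serves both as norm bound and as truncation level, so the pointwise
    bound becomes \<delta> * (1 + 1 / C).\<close>
  define \<delta> where "\<delta> = \<epsilon> / (1 + 1 / C)"
  have \<delta>: "\<delta> > 0" using \<epsilon> C by (simp add: \<delta>_def add_pos_pos)
  have "cmod (f (Some z)) \<le> \<epsilon>"
    if f: "f \<in> bergman_space p \<Omega>" "bergman_norm p \<Omega> f < \<delta>" and z: "z \<in> K" for f z
  proof -
    have "bergman_energy p f \<le> ennreal (\<delta> powr p)"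
      using f(2) p bergman_norm_nonneg by (auto simp: bergman_energy_eq_norm[OF \<Omega> f(1)] intro!: ennreal_leI powr_mono2)
    then have \<nu>: "(\<integral>\<^sup>+w. ennreal (cmod (f (Some w)) powr p * sphere_density w) * indicator (ball z s) w \<partial>lborel)
      \<le> ennreal (\<delta> powr p)"
      unfolding bergman_energy_def
      by (rule order_trans[rotated]) (auto intro!: nn_integral_mono simp: indicator_def)
    have "cmod (f (Some z)) \<le> \<delta> + \<delta> powr (1 - p) * \<delta> powr p / (pi * s\<^sup>2 * D)"
    proof (rule bergman_pointwise_bound[OF \<Omega> p _ s(1) _ D _ \<nu> _ \<delta>])
      show "f \<in> sphere_holomorphic \<Omega>" using f \<Omega> by (simp add: bergman_space_iff)
      fix w assume w: "w \<in> ball z s"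
      show "Some w \<in> \<Omega>" using s(2) z w by blast
      have "cmod w \<le> cmod z + cmod (w - z)"
        using norm_triangle_ineq[of z "w - z"] by simp
      then have "cmod w \<le> B + s" using w B(2)[OF z] by (auto simp: dist_norm norm_minus_commute)
      then show "D \<le> sphere_density w"
        unfolding D_def using B(1) s(1) by (intro sphere_density_mono) (simp add: norm_of_real del: of_real_add)
    qed simp
    also have "\<delta> powr (1 - p) * \<delta> powr p = \<delta>" using \<delta> by (simp flip: powr_add)
    also have "\<delta> + \<delta> / (pi * s\<^sup>2 * D) = \<delta> * (1 + 1 / C)" by (simp add: C_def distrib_left)
    also have "\<dots> = \<epsilon>"
    proof -
      have "1 + 1 / C > 0" using C by (simp add: add_pos_pos)
      then show ?thesis by (simp add: \<delta>_def)
    qed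
    finally show ?thesis .
  qed
  with \<delta> show thesis by (rule that)
qed

lemma sphere_holomorphic_eq_0:
  assumes "f \<in> sphere_holomorphic \<Omega>" "\<not> (x \<in> \<Omega> \<and> x \<noteq> None)"
  shows "f x = 0"
  using assms by (cases "x \<in> \<Omega>") (simp_all add: sphere_holomorphic_def)

text \<open>Beyond Minkowski, the point is definiteness: a function of norm 0 lies below every
  threshold for evaluations, so its value at each finite point of \<Omega> is below every
  \<epsilon>.\<close>

lemma Metric_space_bergman:
  assumes \<Omega>: "openin sphere_topology \<Omega>" and p: "p \<ge> 1"
  shows "Metric_space (bergman_space p \<Omega>) (\<lambda>f g. bergman_norm p \<Omega> (\<lambda>x. f x - g x))"
proof (rule Metric_space.intro)
  fix f g h
  show "bergman_norm p \<Omega> (\<lambda>x. f x - g x) \<ge> 0" by (rule bergman_norm_nonneg)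
  show "bergman_norm p \<Omega> (\<lambda>x. f x - g x) = bergman_norm p \<Omega> (\<lambda>x. g x - f x)"
    by (simp add: bergman_norm_def norm_minus_commute)
  assume f: "f \<in> bergman_space p \<Omega>" and g: "g \<in> bergman_space p \<Omega>"
  have hol: "f \<in> sphere_holomorphic \<Omega>" "g \<in> sphere_holomorphic \<Omega>"
    using f g \<Omega> by (simp_all add: bergman_space_iff)
  show "bergman_norm p \<Omega> (\<lambda>x. f x - g x) = 0 \<longleftrightarrow> f = g"
  proof
    assume 0: "bergman_norm p \<Omega> (\<lambda>x. f x - g x) = 0"
    note d = bergman_diff[OF \<Omega> p f g]
    show "f = g"
    proof
      fix x
      show "f x = g x"
      proof (cases "x \<in> \<Omega> \<and> x \<noteq> None")
        case False
        then show ?thesis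
          using sphere_holomorphic_eq_0[of f \<Omega> x] sphere_holomorphic_eq_0[of g \<Omega> x] hol by simp
      next
        case True
        then obtain z where z: "x = Some z" "Some z \<in> \<Omega>" by auto
        have "cmod (f (Some z) - g (Some z)) \<le> \<epsilon>" if \<epsilon>: "\<epsilon> > 0" for \<epsilon>
        proof -
          obtain \<delta> where \<delta>: "\<delta> > 0"
            "\<And>f w. f \<in> bergman_space p \<Omega> \<Longrightarrow> bergman_norm p \<Omega> f < \<delta> \<Longrightarrow> w \<in> {z} \<Longrightarrow> cmod (f (Some w)) \<le> \<epsilon>"
          proof (rule bergman_evaluation_equicontinuous[OF \<Omega> p compact_sing[of z] _ \<epsilon>])
            show "Some w \<in> \<Omega>" if "w \<in> {z}" for w using that z by simp
          qed auto
          show ?thesis using \<delta>(2)[OF d, of z] \<delta>(1) 0 by simp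
        qed
        then have "cmod (f (Some z) - g (Some z)) \<le> 0 + \<epsilon>" if "\<epsilon> > 0" for \<epsilon>
          using that by simp
        then have "cmod (f (Some z) - g (Some z)) \<le> 0"
          by (rule field_le_epsilon)
        then show ?thesis using z by simp
      qed
    qed
  qed (simp add: bergman_norm_def)
  assume h: "h \<in> bergman_space p \<Omega>"
  show "bergman_norm p \<Omega> (\<lambda>x. f x - h x) \<le> bergman_norm p \<Omega> (\<lambda>x. f x - g x) + bergman_norm p \<Omega> (\<lambda>x. g x - h x)"
    using bergman_minkowski(2)[OF \<Omega> p bergman_diff[OF \<Omega> p f g] bergman_diff[OF \<Omega> p g h]] by simp
qed

section \<open>Integrability of simple poles\<close>

text \<open>\<open>h\<close> is dominated by the series of \<open>c n\<close> times the indicators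
  of the balls, integrated termwise. With dyadic radii this takes the place of an integral in polar
  coordinates.\<close>

lemma nn_integral_finite_by_balls:
  fixes h :: "complex \<Rightarrow> ennreal"
  assumes h: "\<And>z. h z \<noteq> 0 \<Longrightarrow> \<exists>n::nat. z \<in> ball a (r n) \<and> h z \<le> ennreal (c n)"
    and nonneg: "\<And>n. c n \<ge> 0" "\<And>n. r n \<ge> 0"
    and summable: "summable (\<lambda>n. c n * (r n)\<^sup>2)"
  shows "(\<integral>\<^sup>+z. h z \<partial>lborel) < \<infinity>"
proof -
  have "(\<integral>\<^sup>+z. h z \<partial>lborel) \<le> (\<integral>\<^sup>+z. (\<Sum>n. ennreal (c n) * indicator (ball a (r n)) z) \<partial>lborel)"
  proof (rule nn_integral_mono)
    fix z
    show "h z \<le> (\<Sum>n. ennreal (c n) * indicator (ball a (r n)) z)"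
    proof (cases "h z = 0")
      case False
      then obtain n where n: "z \<in> ball a (r n)" "h z \<le> ennreal (c n)" using h by blast
      then have "h z \<le> (\<Sum>k\<in>{n}. ennreal (c k) * indicator (ball a (r k)) z)" by simp
      also have "\<dots> \<le> (\<Sum>n. ennreal (c n) * indicator (ball a (r n)) z)"
        by (rule sum_le_suminf) auto
      finally show ?thesis .
    qed simp
  qed
  also have "\<dots> = (\<Sum>n. ennreal (c n * (pi * (r n)\<^sup>2)))"
  proof (subst nn_integral_suminf)
    fix n
    have [measurable]: "(indicator (ball a (r n)) :: complex \<Rightarrow> ennreal) \<in> borel_measurable borel"
      by (intro borel_measurable_indicator) auto
    show "(\<lambda>z. ennreal (c n) * indicator (ball a (r n)) z) \<in> borel_measurable lborel"
      by measurable
  qed (simp add: nonneg nn_integral_cmult_indicator emeasure_ball unit_ball_vol_2 ennreal_mult)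
  also have "\<dots> < \<infinity>"
  proof -
    have "(\<lambda>n. pi * (c n * (r n)\<^sup>2)) = (\<lambda>n. c n * (pi * (r n)\<^sup>2))"
      by (simp add: mult_ac)
    then have "summable (\<lambda>n. c n * (pi * (r n)\<^sup>2))"
      using summable_mult[OF summable, of pi] by simp
    then have "(\<Sum>n. ennreal (c n * (pi * (r n)\<^sup>2))) \<noteq> top"
      using nonneg by (intro ennreal_suminf_neq_top) auto
    then show ?thesis by (simp add: less_top)
  qed
  finally show ?thesis .
qed

text \<open>A geometric series with ratio 2 powr (q - 2). Both singularities, at a finite point and
  at infinity, lead to this series.\<close>

lemma summable_dyadic:
  fixes q C :: real
  assumes "q < 2"
  shows "summable (\<lambda>n. C * 2 powr (real n * (q - 2)))"
proof -
  have "2 powr (real n * (q - 2)) = (2 powr (q - 2)) ^ n" for n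
    by (simp add: powr_power)
  moreover have "2 powr (q - 2) < (1::real)"
    using assms by (simp add: powr_less_one)
  ultimately show ?thesis
    by (simp add: summable_mult summable_geometric)
qed

lemma nn_integral_norm_powr_ball_finite:
  fixes q :: real
  assumes q: "0 \<le> q" "q < 2"
  shows "(\<integral>\<^sup>+z. ennreal (cmod (z - a) powr (- q)) * indicator (ball a 1) z \<partial>lborel) < \<infinity>"
proof (rule nn_integral_finite_by_balls)
  fix z
  assume "ennreal (cmod (z - a) powr (- q)) * indicator (ball a 1) z \<noteq> 0"
  \<comment> \<open>The value of \<open>0 powr (- q)\<close> is 0, so the integrand vanishes at
    \<open>a\<close> itself.\<close>
  then have z: "z \<noteq> a" "cmod (z - a) < 1"
    by (auto simp: indicator_def dist_norm norm_minus_commute split: if_splits)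
  define t where "t = cmod (z - a)"
  have t: "0 < t" "t < 1" using z by (auto simp: t_def)
  \<comment> \<open>The dyadic annulus of \<open>z\<close>: subtracting 1 from the ceiling gives
    2^(-n-1) \<le> t < 2^(-n), strict on the side of the open ball.\<close>
  define n where "n = nat (\<lceil>- log 2 t\<rceil> - 1)"
  have "- log 2 t > 0" using t by simp
  then have n: "real n < - log 2 t" "- log 2 t \<le> real n + 1"
    unfolding n_def by linarith+
  have "2 powr (log 2 t) < 2 powr (- real n)" "2 powr (- (real n + 1)) \<le> 2 powr (log 2 t)"
    using n by (intro powr_less_mono powr_mono; linarith)+
  then have t_le: "t < 2 powr (- real n)" "2 powr (- (real n + 1)) \<le> t"
    using t by simp_all
  have "t powr (- q) \<le> (2 powr (- (real n + 1))) powr (- q)"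
    using t_le q by (intro powr_mono2') auto
  also have "\<dots> = 2 powr ((real n + 1) * q)"
    unfolding powr_powr by (simp add: algebra_simps)
  finally have "cmod (z - a) powr (- q) \<le> 2 powr ((real n + 1) * q)" by (simp add: t_def)
  then have "z \<in> ball a (2 powr (- real n)) \<and>
      ennreal (cmod (z - a) powr (- q)) * indicator (ball a 1) z \<le> ennreal (2 powr ((real n + 1) * q))"
    using t_le(1) by (auto simp: t_def dist_norm norm_minus_commute indicator_def ennreal_leI)
  then show "\<exists>n. z \<in> ball a (2 powr (- real n)) \<and>
      ennreal (cmod (z - a) powr (- q)) * indicator (ball a 1) z \<le> ennreal (2 powr ((real n + 1) * q))" ..
next
  have "2 powr ((real n + 1) * q) * (2 powr (- real n))\<^sup>2 = 2 powr q * 2 powr (real n * (q - 2))" for n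
    by (simp add: powr_power powr_add[symmetric] algebra_simps)
  then show "summable (\<lambda>n. 2 powr ((real n + 1) * q) * (2 powr (- real n))\<^sup>2)"
    using summable_dyadic[OF q(2)] by (simp only:)
qed auto

text \<open>On the n-th dyadic annulus the density is of order 2^(-4n), the ball has area of order
  2^(2n), and the power is at most 2^((n+1)q), which leaves terms of order 2^(n(q-2)).\<close>

lemma nn_integral_sphere_density_powr_finite:
  fixes q :: real
  assumes q: "0 \<le> q" "q < 2"
  shows "(\<integral>\<^sup>+z. ennreal ((1 + cmod z) powr q * sphere_density z) \<partial>lborel) < \<infinity>"
proof (rule nn_integral_finite_by_balls)
  fix z
  define n where "n = (LEAST n. cmod z < 2 ^ n)"
  have "\<exists>n. cmod z < 2 ^ n" by (rule real_arch_pow) simp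
  then have n: "cmod z < 2 ^ n" unfolding n_def by (rule LeastI_ex)
  \<comment> \<open>Minimality of \<open>n\<close> gives only 2^(n-1) \<le> |z|; the lost factor 2,
    to the fourth power, is the constant 16. For n = 0 the density is at most 1.\<close>
  have d: "sphere_density z \<le> 16 * 2 powr (- (4 * real n))"
  proof (cases n)
    case 0
    have "pi * (1 + (cmod z)\<^sup>2)\<^sup>2 \<ge> 1 * 1"
      using pi_gt3 by (intro mult_mono one_le_power) auto
    then show ?thesis using 0 by (simp add: sphere_density_def field_simps)
  next
    case (Suc m)
    then have "m < (LEAST n. cmod z < 2 ^ n)" by (simp add: n_def)
    then have m: "2 ^ m \<le> cmod z" using not_less_Least by fastforce
    have "(2 ^ m) ^ 4 \<le> (cmod z) ^ 4" using m by (intro power_mono) auto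
    also have "\<dots> = 1 * ((cmod z)\<^sup>2)\<^sup>2" by simp
    also have "\<dots> \<le> pi * (1 + (cmod z)\<^sup>2)\<^sup>2"
      using pi_gt3 by (intro mult_mono power_mono) auto
    finally have "sphere_density z \<le> 1 / (2 ^ m) ^ 4"
      unfolding sphere_density_def by (intro divide_left_mono) (auto intro!: mult_pos_pos)
    also have "(2 ^ m) ^ 4 = (2::real) powr (4 * real m)"
    proof -
      have "(2::real) ^ m = 2 powr real m" by (simp add: powr_realpow)
      then show ?thesis by (simp only:) (simp add: powr_power)
    qed
    also have "1 / \<dots> = 2 powr (- (4 * real m))" by (simp add: powr_minus_divide)
    also have "\<dots> = 2 powr (4 + - (4 * real n))" by (simp add: Suc)
    also have "\<dots> = 16 * 2 powr (- (4 * real n))" by (subst powr_add) simp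
    finally show ?thesis .
  qed
  have "1 + cmod z \<le> 2 * 2 ^ n" using n one_le_power[of "2::real" n] by linarith
  also have "\<dots> = 2 powr (real n + 1)" by (simp add: powr_add powr_realpow)
  finally have "(1 + cmod z) powr q \<le> (2 powr (real n + 1)) powr q"
    using q by (intro powr_mono2) auto
  then have "(1 + cmod z) powr q \<le> 2 powr ((real n + 1) * q)" by (simp add: powr_powr)
  then have "(1 + cmod z) powr q * sphere_density z \<le> 2 powr ((real n + 1) * q) * (16 * 2 powr (- (4 * real n)))"
    using d sphere_density_pos[of z] by (intro mult_mono) auto
  then show "\<exists>n. z \<in> ball 0 (2 ^ n) \<and>
      ennreal ((1 + cmod z) powr q * sphere_density z)
      \<le> ennreal (2 powr ((real n + 1) * q) * (16 * 2 powr (- (4 * real n))))"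
    using n by (intro exI[of _ n]) (auto simp: ennreal_leI)
next
  have "2 powr ((real n + 1) * q) * (16 * 2 powr (- (4 * real n))) * (2 ^ n)\<^sup>2
      = (16 * 2 powr q) * 2 powr (real n * (q - 2))" for n
  proof -
    have "(2::real) ^ n = 2 powr real n" by (simp add: powr_realpow)
    then have "((2::real) ^ n)\<^sup>2 = 2 powr (2 * real n)"
      by (simp only:) (simp add: powr_power)
    then show ?thesis
      by (simp add: powr_add[symmetric] algebra_simps)
  qed
  then show "summable (\<lambda>n. 2 powr ((real n + 1) * q) * (16 * 2 powr (- (4 * real n))) * (2 ^ n)\<^sup>2)"
    using summable_dyadic[OF q(2)] by (simp only:)
qed auto

section \<open>Residues at an isolated point of the complement\<close>

text \<open>\<open>f\<close>, read in the chart \<open>c\<close>, has at \<open>a\<close> a pole of order at most one with residue \<open>k\<close>.\<close>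

definition simple_pole_in_chart ::
    "(complex \<Rightarrow> sphere) \<Rightarrow> complex \<Rightarrow> real \<Rightarrow> (sphere \<Rightarrow> complex) \<Rightarrow> complex \<Rightarrow> bool" where
  "simple_pole_in_chart c a \<rho> f k \<longleftrightarrow>
     (\<exists>g. g holomorphic_on ball a \<rho> \<and> g a = k \<and> (\<forall>w\<in>ball a \<rho> - {a}. f (c w) = g w / (w - a)))"

lemma simple_pole_in_chart_diff:
  assumes "simple_pole_in_chart c a \<rho> f k" "simple_pole_in_chart c a \<rho> f' k'"
  shows "simple_pole_in_chart c a \<rho> (\<lambda>x. f x - f' x) (k - k')"
proof -
  from assms obtain g g' where "g holomorphic_on ball a \<rho>" "g a = k"
      "\<forall>w\<in>ball a \<rho> - {a}. f (c w) = g w / (w - a)"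
      "g' holomorphic_on ball a \<rho>" "g' a = k'" "\<forall>w\<in>ball a \<rho> - {a}. f' (c w) = g' w / (w - a)"
    unfolding simple_pole_in_chart_def by blast
  then show ?thesis
    unfolding simple_pole_in_chart_def
    by (intro exI[of _ "\<lambda>w. g w - g' w"]) (auto intro!: holomorphic_intros simp: diff_divide_distrib)
qed

text \<open>The maximum principle for g, which is (w - a) f off the centre, on the disc of half the
  radius. Together with the bound on evaluations over compact sets it makes the residue
  continuous.\<close>

lemma simple_pole_in_chart_bound:
  assumes f: "simple_pole_in_chart c a \<rho> f k" and \<rho>: "\<rho> > 0"
    and bound: "\<And>w. w \<in> sphere a (\<rho> / 2) \<Longrightarrow> cmod (f (c w)) \<le> \<epsilon>"
  shows "cmod k \<le> \<epsilon> * (\<rho> / 2)"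
proof -
  from f obtain g where g: "g holomorphic_on ball a \<rho>" "g a = k"
      "\<And>w. w \<in> ball a \<rho> - {a} \<Longrightarrow> f (c w) = g w / (w - a)"
    unfolding simple_pole_in_chart_def by blast
  have "cmod (g a) \<le> \<epsilon> * (\<rho> / 2)"
  proof (rule maximum_modulus_frontier[of g "ball a (\<rho> / 2)"])
    show "g holomorphic_on interior (ball a (\<rho> / 2))"
      using \<rho> by (auto intro: holomorphic_on_subset[OF g(1)])
    show "continuous_on (closure (ball a (\<rho> / 2))) g"
      using \<rho> by (auto intro!: continuous_on_subset[OF holomorphic_on_imp_continuous_on[OF g(1)]])
    fix w assume "w \<in> frontier (ball a (\<rho> / 2))"
    then have w: "w \<in> sphere a (\<rho> / 2)" using \<rho> by (simp add: frontier_ball)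
    then have d: "cmod (w - a) = \<rho> / 2" by (simp add: dist_norm norm_minus_commute)
    have "cmod (g w) / (\<rho> / 2) \<le> \<epsilon>"
      using bound[OF w] g(3)[of w] w \<rho> d by (auto simp: norm_divide)
    then show "cmod (g w) \<le> \<epsilon> * (\<rho> / 2)" using \<rho> by (simp add: pos_divide_le_eq)
  qed (use \<rho> in auto)
  with g(2) show ?thesis by simp
qed

text \<open>The hypothesis makes (w - a)^2 f extend holomorphically by the value 0 at
  \<open>a\<close>; because this extension \<open>H\<close> vanishes there, a factor w - a can be
  divided out, and the quotient is the required \<open>g\<close>.\<close>

lemma simple_pole_in_chartI:
  assumes hol: "(\<lambda>w. f (c w)) holomorphic_on ball a \<rho> - {a}" and \<rho>: "\<rho> > 0"
    and lim: "\<And>\<epsilon>. \<epsilon> > 0 \<Longrightarrow> \<exists>r>0. \<forall>w. 0 < cmod (w - a) \<and> cmod (w - a) < r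
      \<longrightarrow> (cmod (w - a))\<^sup>2 * cmod (f (c w)) \<le> \<epsilon>"
  shows "\<exists>k. simple_pole_in_chart c a \<rho> f k"
proof -
  define h where "h = (\<lambda>w. (w - a)\<^sup>2 * f (c w))"
  define H where "H = (\<lambda>w. if w = a then 0 else h w)"
  have holh: "h holomorphic_on ball a \<rho> - {a}"
    unfolding h_def by (intro holomorphic_intros hol)
  have "H holomorphic_on ball a \<rho>"
  proof (rule no_isolated_singularity')
    fix z assume "z \<in> {a}"
    have "(h \<longlongrightarrow> 0) (at a within ball a \<rho>)"
      unfolding tendsto_iff eventually_at
    proof (intro allI impI)
      fix e :: real assume e: "e > 0"
      then obtain r where r: "r > 0" "\<And>w. 0 < cmod (w - a) \<Longrightarrow> cmod (w - a) < r
          \<Longrightarrow> (cmod (w - a))\<^sup>2 * cmod (f (c w)) \<le> e / 2"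
        using lim[of "e / 2"] by auto
      show "\<exists>d>0. \<forall>w\<in>ball a \<rho>. w \<noteq> a \<and> dist w a < d \<longrightarrow> dist (h w) 0 < e"
      proof (intro exI[of _ r] conjI ballI impI r)
        fix w assume "w \<noteq> a \<and> dist w a < r"
        then have "(cmod (w - a))\<^sup>2 * cmod (f (c w)) \<le> e / 2"
          by (intro r) (auto simp: dist_norm)
        then show "dist (h w) 0 < e" using e by (simp add: h_def norm_mult norm_power)
      qed
    qed
    then have "(H \<longlongrightarrow> 0) (at a within ball a \<rho>)"
      by (rule Lim_transform_eventually) (auto simp: H_def eventually_at_filter)
    with \<open>z \<in> {a}\<close> show "(H \<longlongrightarrow> H z) (at z within ball a \<rho>)" by (simp add: H_def)
  next
    show "H holomorphic_on ball a \<rho> - {a}"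
      using holh by (rule holomorphic_transform) (simp add: H_def)
  qed auto
  then have "(\<lambda>w. if w = a then deriv H a else (H w - H a) / (w - a)) holomorphic_on ball a \<rho>"
    by (intro pole_lemma_open) auto
  then show ?thesis
    unfolding simple_pole_in_chart_def
    by (intro exI[of _ "deriv H a"] exI[of _ "\<lambda>w. if w = a then deriv H a else (H w - H a) / (w - a)"])
      (auto simp: H_def h_def power2_eq_square)
qed

section \<open>Residues along an orbit\<close>

text \<open>If |\<alpha>| \<le> 1 or k0 = 0, the sequence stays in the disc of radius |k0|, and a
  point outside it will do; otherwise the sequence stays at distance at least |k0| from 0.\<close>

lemma exists_value_away_from_geometric_orbit:
  fixes \<alpha> k0 :: complex
  obtains k \<eta> where "\<eta> > 0" "\<And>n. \<eta> < cmod (k - \<alpha> ^ n * k0)"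
proof (cases "cmod \<alpha> \<le> 1 \<or> k0 = 0")
  case True
  have "1 < cmod (of_real (cmod k0 + 2) - \<alpha> ^ n * k0)" for n
  proof -
    have "cmod (\<alpha> ^ n * k0) \<le> cmod k0"
      using True power_le_one[of "cmod \<alpha>" n] by (auto simp: norm_mult norm_power intro: mult_left_le_one_le)
    moreover have "cmod (of_real (cmod k0 + 2) :: complex) = cmod k0 + 2"
      by (simp only: norm_of_real) simp
    ultimately show ?thesis
      using norm_triangle_ineq2[of "of_real (cmod k0 + 2)" "\<alpha> ^ n * k0"] by linarith
  qed
  then show thesis by (intro that[of 1]) auto
next
  case False
  have "cmod k0 / 2 < cmod (0 - \<alpha> ^ n * k0)" for n
  proof -
    have "1 * cmod k0 \<le> cmod \<alpha> ^ n * cmod k0"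
      using False by (intro mult_right_mono one_le_power) auto
    moreover have "cmod k0 > 0" using False by simp
    ultimately show ?thesis by (simp add: norm_mult norm_power)
  qed
  then show thesis using False by (intro that[of "cmod k0 / 2" 0]) auto
qed

text \<open>The residue is an eigenfunctional, with eigenvalue \<open>\<alpha>\<close>, of the adjoint of \<open>T\<close>; along an orbit
  it runs through a geometric sequence, which is not dense.\<close>

lemma not_hypercyclic_if_simple_poles:
  assumes \<Omega>: "openin sphere_topology \<Omega>" and p: "p \<ge> 1" and \<rho>: "\<rho> > 0"
    and K: "compact K" "\<And>z. z \<in> K \<Longrightarrow> Some z \<in> \<Omega>" "c ` sphere a (\<rho> / 2) \<subseteq> Some ` K"
    and pole: "\<And>f. f \<in> bergman_space p \<Omega> \<Longrightarrow> \<exists>k. simple_pole_in_chart c a \<rho> f k"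
    and shift: "\<And>f k. simple_pole_in_chart c a \<rho> f k \<Longrightarrow> simple_pole_in_chart c a \<rho> (T f) (\<alpha> * k)"
    and onto: "\<And>k. \<exists>f\<in>bergman_space p \<Omega>. simple_pole_in_chart c a \<rho> f k"
  shows "\<not> hypercyclic (bergman_topology p \<Omega>) T"
proof
  assume hyp: "hypercyclic (bergman_topology p \<Omega>) T"
  interpret Metric_space "bergman_space p \<Omega>" "\<lambda>f g. bergman_norm p \<Omega> (\<lambda>x. f x - g x)"
    by (rule Metric_space_bergman[OF \<Omega> p])
  from hyp obtain x where x: "x \<in> bergman_space p \<Omega>"
      "mtopology closure_of (range (\<lambda>n. (T ^^ n) x)) = bergman_space p \<Omega>"
    unfolding hypercyclic_def bergman_topology_def by auto
  obtain k0 where k0: "simple_pole_in_chart c a \<rho> x k0" using pole[OF x(1)] by blast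
  have orbit: "simple_pole_in_chart c a \<rho> ((T ^^ n) x) (\<alpha> ^ n * k0)" for n
    by (induction n) (use k0 shift in \<open>auto simp: mult.assoc\<close>)
  obtain k \<eta> where \<eta>: "\<eta> > 0" "\<And>n. \<eta> < cmod (k - \<alpha> ^ n * k0)"
    using exists_value_away_from_geometric_orbit[of \<alpha> k0] by blast
  obtain y where y: "y \<in> bergman_space p \<Omega>" "simple_pole_in_chart c a \<rho> y k"
    using onto by blast
  \<comment> \<open>The tolerance on the circle of radius \<rho> / 2 that the maximum principle
    turns into an error of at most \<eta> for the residue.\<close>
  have "\<eta> / (\<rho> / 2) > 0" using \<eta> \<rho> by simp
  then obtain \<delta> where \<delta>: "\<delta> > 0"
    "\<And>f z. f \<in> bergman_space p \<Omega> \<Longrightarrow> bergman_norm p \<Omega> f < \<delta> \<Longrightarrow> z \<in> K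
      \<Longrightarrow> cmod (f (Some z)) \<le> \<eta> / (\<rho> / 2)"
    using bergman_evaluation_equicontinuous[OF \<Omega> p K(1,2)] by blast
  from y(1) x(2) \<delta>(1) obtain n where n: "(T ^^ n) x \<in> mball y \<delta>"
    unfolding metric_closure_of by blast
  let ?d = "\<lambda>t. y t - (T ^^ n) x t"
  have d: "?d \<in> bergman_space p \<Omega>" "bergman_norm p \<Omega> ?d < \<delta>"
    using n bergman_diff[OF \<Omega> p y(1)] by auto
  have "cmod (k - \<alpha> ^ n * k0) \<le> \<eta> / (\<rho> / 2) * (\<rho> / 2)"
  proof (rule simple_pole_in_chart_bound[OF simple_pole_in_chart_diff[OF y(2) orbit] \<rho>])
    fix w assume "w \<in> sphere a (\<rho> / 2)"
    then obtain z where "z \<in> K" "c w = Some z" using K(3) by blast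
    then show "cmod (y (c w) - (T ^^ n) x (c w)) \<le> \<eta> / (\<rho> / 2)"
      using \<delta>(2)[OF d] by simp
  qed
  also have "\<dots> = \<eta>" using \<rho> by simp
  finally show False using \<eta>(2)[of n] by simp
qed

section \<open>Order of the pole of a Bergman function\<close>

text \<open>Continuity from above of the finite measure with density |f|^p against spherical area.
  The sets will be punctured discs shrinking to a pole, or exteriors of growing discs.\<close>

lemma bergman_energy_tail:
  assumes \<Omega>: "openin sphere_topology \<Omega>" and f: "f \<in> bergman_space p \<Omega>"
    and A: "\<And>n::nat. A n \<in> sets borel" "decseq A" "(\<Inter>n. A n) = {}" and \<epsilon>: "\<epsilon> > 0"
  obtains n where
    "(\<integral>\<^sup>+w. ennreal (cmod (f (Some w)) powr p * sphere_density w) * indicator (A n) w \<partial>lborel) < ennreal \<epsilon>"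
proof -
  have fin: "bergman_energy p f < \<infinity>" "f \<in> sphere_holomorphic \<Omega>"
    using f \<Omega> by (simp_all add: bergman_space_iff)
  note [measurable] = sphere_holomorphic_measurable[OF \<Omega> fin(2)]
  let ?e = "\<lambda>w. ennreal (cmod (f (Some w)) powr p * sphere_density w)"
  define N where "N = density lborel ?e"
  have N: "emeasure N B = (\<integral>\<^sup>+w. ?e w * indicator B w \<partial>lborel)" if "B \<in> sets borel" for B
    unfolding N_def using that by (intro emeasure_density) auto
  have "(\<lambda>n. emeasure N (A n)) \<longlonglongrightarrow> emeasure N (\<Inter>n. A n)"
  proof (rule Lim_emeasure_decseq)
    show "range A \<subseteq> sets N" using A(1) by (auto simp: N_def)
    fix n
    have "emeasure N (A n) \<le> bergman_energy p f"
      unfolding N[OF A(1)] bergman_energy_def by (intro nn_integral_mono) (auto simp: indicator_def)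
    then show "emeasure N (A n) \<noteq> \<infinity>" using fin(1) by (auto simp: top_unique)
  qed (rule A)
  then have "(\<lambda>n. emeasure N (A n)) \<longlonglongrightarrow> 0" by (simp add: A(3))
  then have "eventually (\<lambda>n. emeasure N (A n) < ennreal \<epsilon>) sequentially"
    using \<epsilon> by (intro order_tendstoD) auto
  then obtain n where "emeasure N (A n) < ennreal \<epsilon>"
    using eventually_happens'[OF sequentially_bot] by blast
  then show thesis using that N[OF A(1)] by simp
qed

text \<open>The pointwise bound with truncation level 1 is used on the disc about \<open>w\<close>
  of radius |w - a| / 2, which avoids \<open>a\<close>; its energy is at most \<nu> once
  \<open>w\<close> is close to \<open>a\<close>.\<close>

lemma bergman_simple_pole_at_finite_point:
  assumes \<Omega>: "openin sphere_topology \<Omega>" and p: "p \<ge> 1" and f: "f \<in> bergman_space p \<Omega>"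
    and \<rho>: "\<rho> > 0" "\<And>z. z \<in> ball a \<rho> - {a} \<Longrightarrow> Some z \<in> \<Omega>"
  shows "\<exists>k. simple_pole_in_chart Some a \<rho> f k"
proof (rule simple_pole_in_chartI)
  have hf: "f \<in> sphere_holomorphic \<Omega>" using f \<Omega> by (simp add: bergman_space_iff)
  show "(\<lambda>w. f (Some w)) holomorphic_on ball a \<rho> - {a}"
    using hf \<rho>(2) unfolding sphere_holomorphic_def by (auto intro: holomorphic_on_subset)
  fix \<epsilon> :: real assume \<epsilon>: "\<epsilon> > 0"
  define D where "D = sphere_density (complex_of_real (cmod a + \<rho>))"
  have D: "D > 0" by (simp add: D_def sphere_density_pos)
  \<comment> \<open>With |w - a| = 2 s, the energy term times |w - a|^2 is 4 * \<nu> / (pi * D),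
    which this choice makes \<epsilon> / 2.\<close>
  define \<nu> where "\<nu> = \<epsilon> * pi * D / 8"
  have \<nu>: "\<nu> > 0" using \<epsilon> D by (simp add: \<nu>_def)
  \<comment> \<open>Removing the centre makes the intersection empty.\<close>
  define A where "A = (\<lambda>n::nat. ball a (1 / (real n + 1)) - {a})"
  have A1: "A n \<in> sets borel" for n by (simp add: A_def)
  have A2: "decseq A"
    unfolding decseq_def
  proof (intro allI impI)
    fix m n :: nat assume "m \<le> n"
    then have "1 / (real n + 1) \<le> 1 / (real m + 1)" by (simp add: frac_le)
    then show "A n \<subseteq> A m" unfolding A_def by (intro Diff_mono subset_ball) auto
  qed
  have A3: "(\<Inter>n. A n) = {}"
  proof -
    have "\<exists>n. w \<notin> A n" for w
    proof (cases "w = a")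
      case False
      then obtain n where "inverse (real (Suc n)) < cmod (a - w)"
        using reals_Archimedean[of "cmod (a - w)"] by auto
      then have "w \<notin> A n" by (auto simp: A_def dist_norm inverse_eq_divide add.commute)
      then show ?thesis ..
    qed (auto simp: A_def)
    then show ?thesis by auto
  qed
  obtain n where n:
    "(\<integral>\<^sup>+w. ennreal (cmod (f (Some w)) powr p * sphere_density w) * indicator (A n) w \<partial>lborel) < ennreal \<nu>"
    using bergman_energy_tail[OF \<Omega> f A1 A2 A3 \<nu>] by blast
  define b where "b = 1 / (real n + 1)"
  have "b > 0" by (simp add: b_def)
  \<comment> \<open>The discs stay within distance 2 r of \<open>a\<close>: the first two bounds put
    them into \<Omega> and into \<open>A n\<close>. The last two give |w - a|^2 \<le> |w - a| <
    \<epsilon> / 2.\<close>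
  define r where "r = min (min (\<rho> / 2) (b / 2)) (min 1 (\<epsilon> / 2))"
  have r: "r > 0" "r \<le> \<rho> / 2" "r \<le> b / 2" "r \<le> 1" "r \<le> \<epsilon> / 2"
    using \<rho>(1) \<epsilon> \<open>b > 0\<close> by (simp_all add: r_def min_le_iff_disj)
  show "\<exists>r>0. \<forall>w. 0 < cmod (w - a) \<and> cmod (w - a) < r \<longrightarrow> (cmod (w - a))\<^sup>2 * cmod (f (Some w)) \<le> \<epsilon>"
  proof (intro exI[of _ r] conjI allI impI r(1))
    fix w assume w: "0 < cmod (w - a) \<and> cmod (w - a) < r"
    define s where "s = cmod (w - a) / 2"
    have s: "s > 0" "cmod (w - a) = 2 * s" using w by (auto simp: s_def)
    have near: "u \<noteq> a \<and> cmod (u - a) < 2 * r" if "u \<in> ball w s" for u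
    proof -
      have u: "cmod (u - w) < s" using that by (simp add: dist_norm norm_minus_commute)
      have "cmod (u - a) \<le> cmod (u - w) + cmod (w - a)"
        using norm_triangle_ineq[of "u - w" "w - a"] by simp
      moreover have "u \<noteq> a" using u s by (auto simp: norm_minus_commute)
      ultimately show ?thesis using u s w by simp
    qed
    have sub: "ball w s \<subseteq> A n"
    proof
      fix u assume "u \<in> ball w s"
      then have "u \<noteq> a" "cmod (u - a) < 2 * r"
        using near by blast+
      moreover from this have "cmod (u - a) < b"
        using r(3) by linarith
      ultimately show "u \<in> A n" by (simp add: A_def b_def dist_norm norm_minus_commute)
    qed
    have "cmod (f (Some w)) \<le> 1 + 1 powr (1 - p) * \<nu> / (pi * s\<^sup>2 * D)"
    proof (rule bergman_pointwise_bound[OF \<Omega> p hf s(1) _ D])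
      fix u assume u: "u \<in> ball w s"
      have "cmod (u - a) < \<rho>" using near[OF u] r(2) by linarith
      then show "Some u \<in> \<Omega>" using near[OF u] \<rho>(2) by (auto simp: dist_norm norm_minus_commute)
      have "cmod u \<le> cmod a + cmod (u - a)"
        using norm_triangle_ineq[of a "u - a"] by simp
      then show "D \<le> sphere_density u"
        unfolding D_def using \<open>cmod (u - a) < \<rho>\<close> \<rho>(1)
        by (intro sphere_density_mono) (simp add: norm_of_real del: of_real_add)
    next
      have "(\<integral>\<^sup>+u. ennreal (cmod (f (Some u)) powr p * sphere_density u) * indicator (ball w s) u \<partial>lborel)
          \<le> (\<integral>\<^sup>+u. ennreal (cmod (f (Some u)) powr p * sphere_density u) * indicator (A n) u \<partial>lborel)"
        using sub by (intro nn_integral_mono mult_left_mono) (auto simp: indicator_def)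
      with n show "(\<integral>\<^sup>+u. ennreal (cmod (f (Some u)) powr p * sphere_density u) * indicator (ball w s) u \<partial>lborel)
          \<le> ennreal \<nu>" by simp
    qed (use \<nu> in auto)
    then have "(cmod (w - a))\<^sup>2 * cmod (f (Some w)) \<le> (cmod (w - a))\<^sup>2 * (1 + \<nu> / (pi * s\<^sup>2 * D))"
      by (intro mult_left_mono) auto
    also have "\<dots> = (cmod (w - a))\<^sup>2 + \<epsilon> / 2"
      using s D by (simp add: distrib_left power_mult_distrib \<nu>_def)
    also have "(cmod (w - a))\<^sup>2 \<le> cmod (w - a) * 1"
      unfolding power2_eq_square using w r(4) by (intro mult_left_mono) auto
    finally show "(cmod (w - a))\<^sup>2 * cmod (f (Some w)) \<le> \<epsilon>" using w r(5) by simp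
  qed
qed (fact \<rho>(1))

text \<open>With m = |1 / w|, the disc about 1 / w of radius m / 2 has area of order m^2 and density
  of order m^(-4), so small energy bounds |f| by a small multiple of m^2, up to the additive
  1.\<close>

lemma bergman_simple_pole_at_infinity:
  assumes \<Omega>: "openin sphere_topology \<Omega>" and p: "p \<ge> 1" and f: "f \<in> bergman_space p \<Omega>"
    and \<rho>: "\<rho> > 0" "\<And>w. w \<in> ball 0 \<rho> - {0} \<Longrightarrow> Some (1 / w) \<in> \<Omega>"
  shows "\<exists>k. simple_pole_in_chart (\<lambda>w. Some (1 / w)) 0 \<rho> f k"
proof (rule simple_pole_in_chartI)
  have hf: "f \<in> sphere_holomorphic \<Omega>" using f \<Omega> by (simp add: bergman_space_iff)
  have "(\<lambda>w. f (sphere_inverse (Some w))) holomorphic_on {w. sphere_inverse (Some w) \<in> \<Omega>}"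
    using hf by (simp add: sphere_holomorphic_def)
  then have "(\<lambda>w. f (sphere_inverse (Some w))) holomorphic_on ball 0 \<rho> - {0}"
    by (rule holomorphic_on_subset) (use \<rho>(2) in auto)
  then show "(\<lambda>w. f (Some (1 / w))) holomorphic_on ball 0 \<rho> - {0}"
    by (rule holomorphic_transform) auto
  fix \<epsilon> :: real assume \<epsilon>: "\<epsilon> > 0"
  \<comment> \<open>The energy term will be 64 * \<nu> * m^2, hence \<epsilon> / 2 after
    multiplication by |w|^2.\<close>
  define \<nu> where "\<nu> = \<epsilon> / 128"
  have \<nu>: "\<nu> > 0" using \<epsilon> by (simp add: \<nu>_def)
  define A where "A = (\<lambda>n::nat. - cball (0::complex) (real n))"
  have A1: "A n \<in> sets borel" for n by (simp add: A_def)
  have A2: "decseq A"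
    unfolding decseq_def A_def by auto
  have A3: "(\<Inter>n. A n) = {}"
  proof -
    have "\<exists>n. w \<notin> A n" for w
      using real_arch_simple[of "cmod w"] by (auto simp: A_def)
    then show ?thesis by auto
  qed
  obtain n where n:
    "(\<integral>\<^sup>+w. ennreal (cmod (f (Some w)) powr p * sphere_density w) * indicator (A n) w \<partial>lborel) < ennreal \<nu>"
    using bergman_energy_tail[OF \<Omega> f A1 A2 A3 \<nu>] by blast
  \<comment> \<open>Every point of the disc has modulus above m / 2, so m has to exceed 2 (n + 1) to
    reach \<open>A n\<close> and 2 / \<rho> to stay in \<Omega>.\<close>
  define r where "r = min (min (\<rho> / 2) (1 / (2 * (real n + 1)))) (min 1 (\<epsilon> / 2))"
  have r: "r > 0" "r \<le> \<rho> / 2" "r \<le> 1 / (2 * (real n + 1))" "r \<le> 1" "r \<le> \<epsilon> / 2"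
    using \<rho>(1) \<epsilon> by (simp_all add: r_def min_le_iff_disj)
  show "\<exists>r>0. \<forall>w. 0 < cmod (w - 0) \<and> cmod (w - 0) < r
      \<longrightarrow> (cmod (w - 0))\<^sup>2 * cmod (f (Some (1 / w))) \<le> \<epsilon>"
  proof (intro exI[of _ r] conjI allI impI r(1))
    fix w :: complex assume "0 < cmod (w - 0) \<and> cmod (w - 0) < r"
    then have w: "0 < cmod w" "cmod w < r" by auto
    define m where "m = cmod (1 / w)"
    have mw: "m * cmod w = 1" "m > 0" using w by (auto simp: m_def norm_divide)
    have m: "m > 2 * (real n + 1)" "m > 2 / \<rho>" "m > 1"
    proof -
      have "1 / r < 1 / cmod w" using w r(1) by (intro divide_strict_left_mono) auto
      moreover have "1 / (1 / (2 * (real n + 1))) \<le> 1 / r" "1 / (\<rho> / 2) \<le> 1 / r" "1 / 1 \<le> 1 / r"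
        using r \<rho>(1) by (intro divide_left_mono; simp)+
      ultimately show "m > 2 * (real n + 1)" "m > 2 / \<rho>" "m > 1"
        by (simp_all add: m_def norm_divide)
    qed
    define s where "s = m / 2"
    have s: "s > 0" using mw by (simp add: s_def)
    \<comment> \<open>On the disc |u| < 3 m / 2, and m > 1, so 1 + |u|^2 \<le> 4 m^2; squaring gives
      the 16.\<close>
    define D where "D = 1 / (16 * pi * m ^ 4)"
    have D: "D > 0" using mw by (simp add: D_def)
    have far: "m / 2 < cmod u \<and> cmod u < 3 * m / 2" if "u \<in> ball (1 / w) s" for u
    proof -
      have u: "cmod (u - 1 / w) < m / 2" using that by (simp add: dist_norm norm_minus_commute s_def)
      have "cmod u \<le> cmod (u - 1 / w) + m"
        using norm_triangle_ineq[of "u - 1 / w" "1 / w"] by (simp add: m_def)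
      moreover have "m \<le> cmod (u - 1 / w) + cmod u"
        using norm_triangle_ineq[of "1 / w - u" u] by (simp add: m_def norm_minus_commute)
      ultimately show ?thesis using u by simp
    qed
    have sub: "ball (1 / w) s \<subseteq> A n"
    proof
      fix u assume "u \<in> ball (1 / w) s"
      with far[of u] m(1) show "u \<in> A n" by (auto simp: A_def)
    qed
    have "cmod (f (Some (1 / w))) \<le> 1 + 1 powr (1 - p) * \<nu> / (pi * s\<^sup>2 * D)"
    proof (rule bergman_pointwise_bound[OF \<Omega> p hf s _ D])
      fix u assume u: "u \<in> ball (1 / w) s"
      have "1 / \<rho> < cmod u" using far[OF u] m(2) by simp
      then have "1 / u \<in> ball 0 \<rho> - {0}"
        using \<rho>(1) mw(2) far[OF u] by (auto simp: norm_divide divide_less_eq mult.commute)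
      then show "Some u \<in> \<Omega>" using \<rho>(2)[of "1 / u"] by auto
      have "(cmod u)\<^sup>2 \<le> (3 * m / 2)\<^sup>2" using far[OF u] by (intro power_mono) auto
      moreover have "1\<^sup>2 \<le> m\<^sup>2" using m(3) by (intro power_mono) auto
      ultimately have "1 + (cmod u)\<^sup>2 \<le> 4 * m\<^sup>2" by (simp add: power_divide power_mult_distrib)
      then have "(1 + (cmod u)\<^sup>2)\<^sup>2 \<le> (4 * m\<^sup>2)\<^sup>2" by (intro power_mono) auto
      then have "pi * (1 + (cmod u)\<^sup>2)\<^sup>2 \<le> pi * (4 * m\<^sup>2)\<^sup>2" by (intro mult_left_mono) auto
      also have "\<dots> = 16 * pi * m ^ 4" by (simp add: power_mult_distrib)
      finally show "D \<le> sphere_density u"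
        unfolding D_def sphere_density_def
        using mw add_pos_nonneg[of 1 "(cmod u)\<^sup>2"]
        by (intro divide_left_mono mult_pos_pos zero_less_power) auto
    next
      have "(\<integral>\<^sup>+u. ennreal (cmod (f (Some u)) powr p * sphere_density u) * indicator (ball (1 / w) s) u \<partial>lborel)
          \<le> (\<integral>\<^sup>+u. ennreal (cmod (f (Some u)) powr p * sphere_density u) * indicator (A n) u \<partial>lborel)"
        using sub by (intro nn_integral_mono mult_left_mono) (auto simp: indicator_def)
      with n show "(\<integral>\<^sup>+u. ennreal (cmod (f (Some u)) powr p * sphere_density u) * indicator (ball (1 / w) s) u \<partial>lborel)
          \<le> ennreal \<nu>" by simp
    qed (use \<nu> in auto)
    also have "1 + 1 powr (1 - p) * \<nu> / (pi * s\<^sup>2 * D) = 1 + 64 * \<nu> * m\<^sup>2"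
      using mw by (simp add: s_def D_def power_divide power2_eq_square power4_eq_xxxx)
    finally have "(cmod w)\<^sup>2 * cmod (f (Some (1 / w))) \<le> (cmod w)\<^sup>2 * (1 + 64 * \<nu> * m\<^sup>2)"
      by (intro mult_left_mono) auto
    also have "\<dots> = (cmod w)\<^sup>2 + 64 * \<nu> * (m * cmod w)\<^sup>2"
      by (simp add: distrib_left power_mult_distrib)
    also have "\<dots> = (cmod w)\<^sup>2 + \<epsilon> / 2"
      by (simp add: mw \<nu>_def)
    also have "(cmod w)\<^sup>2 \<le> cmod w * 1"
      unfolding power2_eq_square using w r(4) by (intro mult_left_mono) auto
    finally show "(cmod (w - 0))\<^sup>2 * cmod (f (Some (1 / w))) \<le> \<epsilon>" using w r(5) by simp
  qed
qed (fact \<rho>(1))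

section \<open>Action of the Taylor shift on residues\<close>

text \<open>Subtracting the constant f(0) leaves the residue alone, and division by w multiplies it
  by 1 / a. The condition \<rho> \<le> |a| keeps 0 out of the disc, so this division preserves
  holomorphy.\<close>

lemma taylor_shift_simple_pole_at_finite_point:
  assumes f: "simple_pole_in_chart Some a \<rho> f k" and \<rho>: "\<rho> \<le> cmod a"
    and sub: "\<And>z. z \<in> ball a \<rho> - {a} \<Longrightarrow> Some z \<in> \<Omega>"
  shows "simple_pole_in_chart Some a \<rho> (taylor_shift \<Omega> f) (1 / a * k)"
proof -
  from f obtain g where g: "g holomorphic_on ball a \<rho>" "g a = k"
      "\<And>w. w \<in> ball a \<rho> - {a} \<Longrightarrow> f (Some w) = g w / (w - a)"
    unfolding simple_pole_in_chart_def by blast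
  have nz: "w \<noteq> 0" if "w \<in> ball a \<rho>" for w
    using that \<rho> by (auto simp: dist_norm)
  show ?thesis
    unfolding simple_pole_in_chart_def
  proof (intro exI[of _ "\<lambda>w. (g w - f (Some 0) * (w - a)) / w"] conjI ballI)
    show "(\<lambda>w. (g w - f (Some 0) * (w - a)) / w) holomorphic_on ball a \<rho>"
      using nz by (intro holomorphic_intros g(1)) auto
    fix w assume w: "w \<in> ball a \<rho> - {a}"
    then have "taylor_shift \<Omega> f (Some w) = (g w / (w - a) - f (Some 0)) / w"
      using sub nz g(3) by (simp add: taylor_shift_def)
    also have "\<dots> = (g w - f (Some 0) * (w - a)) / w / (w - a)"
      using w nz[of w] by (simp add: field_simps)
    finally show "taylor_shift \<Omega> f (Some w) = (g w - f (Some 0) * (w - a)) / w / (w - a)" .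
  qed (simp add: g(2))
qed

text \<open>In the chart w = 1 / z, division by z is multiplication by w, which cancels the
  pole.\<close>

lemma taylor_shift_simple_pole_at_infinity:
  assumes f: "simple_pole_in_chart (\<lambda>w. Some (1 / w)) 0 \<rho> f k"
    and sub: "\<And>w. w \<in> ball 0 \<rho> - {0} \<Longrightarrow> Some (1 / w) \<in> \<Omega>"
  shows "simple_pole_in_chart (\<lambda>w. Some (1 / w)) 0 \<rho> (taylor_shift \<Omega> f) 0"
proof -
  from f obtain g where g: "g holomorphic_on ball 0 \<rho>"
      "\<And>w. w \<in> ball 0 \<rho> - {0} \<Longrightarrow> f (Some (1 / w)) = g w / (w - 0)"
    unfolding simple_pole_in_chart_def by blast
  show ?thesis
    unfolding simple_pole_in_chart_def
  proof (intro exI[of _ "\<lambda>w. w * g w - w\<^sup>2 * f (Some 0)"] conjI ballI)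
    show "(\<lambda>w. w * g w - w\<^sup>2 * f (Some 0)) holomorphic_on ball 0 \<rho>"
      by (intro holomorphic_intros g(1))
    fix w assume w: "w \<in> ball 0 \<rho> - {0::complex}"
    then have "taylor_shift \<Omega> f (Some (1 / w)) = (g w / w - f (Some 0)) / (1 / w)"
      using sub g(2) by (simp add: taylor_shift_def)
    also have "\<dots> = (w * g w - w\<^sup>2 * f (Some 0)) / (w - 0)"
      using w by (simp add: field_simps power2_eq_square)
    finally show "taylor_shift \<Omega> f (Some (1 / w)) = (w * g w - w\<^sup>2 * f (Some 0)) / (w - 0)" .
  qed simp
qed

section \<open>Bergman functions with prescribed residue\<close>

lemma sphere_density_le_1: "sphere_density z \<le> 1"
proof -
  have "pi * (1 + (cmod z)\<^sup>2)\<^sup>2 \<ge> 1 * 1"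
    using pi_gt3 by (intro mult_mono one_le_power) auto
  then show ?thesis by (simp add: sphere_density_def divide_le_eq)
qed

text \<open>The witness is k / (z - a), which vanishes at infinity. Its p-th power is integrable
  near \<open>a\<close> because p < 2, and is bounded away from \<open>a\<close>.\<close>

lemma bergman_space_contains_simple_pole_at_finite_point:
  assumes \<Omega>: "openin sphere_topology \<Omega>" and p: "1 \<le> p" "p < 2" and a: "Some a \<notin> \<Omega>"
    and sub: "\<And>z. z \<in> ball a \<rho> - {a} \<Longrightarrow> Some z \<in> \<Omega>"
  shows "\<exists>f\<in>bergman_space p \<Omega>. simple_pole_in_chart Some a \<rho> f k"
proof
  define f where "f = (\<lambda>x. if x \<in> \<Omega> then (case x of None \<Rightarrow> 0 | Some z \<Rightarrow> k / (z - a)) else 0)"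
  have "(\<lambda>z. k / (z - a)) holomorphic_on {z. Some z \<in> \<Omega>}"
    using a by (intro holomorphic_intros) auto
  then have 1: "(\<lambda>z. f (Some z)) holomorphic_on {z. Some z \<in> \<Omega>}"
    by (rule holomorphic_transform) (auto simp: f_def)
  \<comment> \<open>In the chart 1 / z the witness reads k w / (1 - a w), whose only possible
    singularity is the excluded point w = 1 / a.\<close>
  have nz: "1 - a * w \<noteq> 0" if "sphere_inverse (Some w) \<in> \<Omega>" for w
  proof
    assume "1 - a * w = 0"
    then have "w \<noteq> 0" "a = 1 / w" by (auto simp: eq_divide_eq)
    with that a show False by simp
  qed
  then have "(\<lambda>w. k * w / (1 - a * w)) holomorphic_on {w. sphere_inverse (Some w) \<in> \<Omega>}"
    by (intro holomorphic_intros) auto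
  then have 2: "(\<lambda>w. f (sphere_inverse (Some w))) holomorphic_on {w. sphere_inverse (Some w) \<in> \<Omega>}"
  proof (rule holomorphic_transform)
    fix w assume w: "w \<in> {w. sphere_inverse (Some w) \<in> \<Omega>}"
    show "k * w / (1 - a * w) = f (sphere_inverse (Some w))"
    proof (cases "w = 0")
      case False
      then have "1 / w - a = (1 - a * w) / w" by (simp add: field_simps)
      then show ?thesis using w False by (simp add: f_def)
    qed (simp add: f_def)
  qed
  have hf: "f \<in> sphere_holomorphic \<Omega>"
    using 1 2 by (simp add: sphere_holomorphic_def f_def)
  \<comment> \<open>The factor with exponent 0 is 1; it brings the far part into the form of the
    density integral with q = 0.\<close>
  have le: "cmod (f (Some z)) powr p * sphere_density z
      \<le> cmod k powr p * (cmod (z - a) powr (- p) * indicator (ball a 1) z + (1 + cmod z) powr 0 * sphere_density z)" for z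
  proof -
    have "cmod (f (Some z)) powr p \<le> cmod k powr p * cmod (z - a) powr (- p)"
    proof -
      have "cmod (k / (z - a)) powr p = cmod k powr p * cmod (z - a) powr (- p)"
        by (simp add: norm_divide powr_divide powr_minus_divide)
      then show ?thesis by (simp add: f_def)
    qed
    then have "cmod (f (Some z)) powr p * sphere_density z
        \<le> (cmod k powr p * cmod (z - a) powr (- p)) * sphere_density z"
      by (intro mult_right_mono) (simp_all add: sphere_density_pos less_imp_le)
    also have "\<dots> = cmod k powr p * (cmod (z - a) powr (- p) * sphere_density z)" by simp
    also have "cmod (z - a) powr (- p) * sphere_density z
        \<le> cmod (z - a) powr (- p) * indicator (ball a 1) z + (1 + cmod z) powr 0 * sphere_density z"
    proof (cases "z \<in> ball a 1")
      case True
      have "cmod (z - a) powr (- p) * sphere_density z \<le> cmod (z - a) powr (- p) * 1"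
        by (intro mult_left_mono sphere_density_le_1) auto
      moreover have "(1 + cmod z) powr 0 * sphere_density z \<ge> 0"
        using sphere_density_pos[of z] by simp
      ultimately show ?thesis using True by (simp add: add_increasing2)
    next
      case False
      then have "cmod (z - a) \<ge> 1" by (simp add: dist_norm norm_minus_commute)
      then have "cmod (z - a) powr (- p) \<le> cmod (z - a) powr 0"
        using p by (intro powr_mono) auto
      then have "cmod (z - a) powr (- p) \<le> 1" using \<open>cmod (z - a) \<ge> 1\<close> by (auto split: if_splits)
      moreover have "1 + cmod z \<noteq> 0" using norm_ge_zero[of z] by linarith
      ultimately show ?thesis
        using False sphere_density_pos[of z] by (simp add: mult_left_le_one_le)
    qed
    finally show ?thesis by (simp add: mult_left_mono)
  qed
  have "bergman_energy p f \<le> (\<integral>\<^sup>+z. ennreal (cmod k powr p)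
      * (ennreal (cmod (z - a) powr (- p)) * indicator (ball a 1) z
        + ennreal ((1 + cmod z) powr 0 * sphere_density z)) \<partial>lborel)"
    unfolding bergman_energy_def
  proof (rule nn_integral_mono)
    fix z
    have "ennreal (cmod (f (Some z)) powr p * sphere_density z)
      \<le> ennreal (cmod k powr p * (cmod (z - a) powr (- p) * indicator (ball a 1) z + (1 + cmod z) powr 0 * sphere_density z))"
      by (rule ennreal_leI[OF le])
    also have "\<dots> = ennreal (cmod k powr p) * ennreal (cmod (z - a) powr (- p) * indicator (ball a 1) z + (1 + cmod z) powr 0 * sphere_density z)"
      using sphere_density_pos[of z] by (intro ennreal_mult add_nonneg_nonneg mult_nonneg_nonneg) auto
    also have "ennreal (cmod (z - a) powr (- p) * indicator (ball a 1) z + (1 + cmod z) powr 0 * sphere_density z)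
      = ennreal (cmod (z - a) powr (- p) * indicator (ball a 1) z) + ennreal ((1 + cmod z) powr 0 * sphere_density z)"
      using sphere_density_pos[of z] by (intro ennreal_plus mult_nonneg_nonneg) auto
    also have "ennreal (cmod (z - a) powr (- p) * indicator (ball a 1) z) = ennreal (cmod (z - a) powr (- p)) * indicator (ball a 1) z"
      by (simp add: indicator_def)
    finally show "ennreal (cmod (f (Some z)) powr p * sphere_density z)
      \<le> ennreal (cmod k powr p) * (ennreal (cmod (z - a) powr (- p)) * indicator (ball a 1) z
        + ennreal ((1 + cmod z) powr 0 * sphere_density z))" .
  qed
  also have "\<dots> = ennreal (cmod k powr p) *
      ((\<integral>\<^sup>+z. ennreal (cmod (z - a) powr (- p)) * indicator (ball a 1) z \<partial>lborel)
        + (\<integral>\<^sup>+z. ennreal ((1 + cmod z) powr 0 * sphere_density z) \<partial>lborel))"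
  proof -
    have [measurable]: "(indicator (ball a 1) :: complex \<Rightarrow> ennreal) \<in> borel_measurable borel"
      by (intro borel_measurable_indicator) auto
    show ?thesis
      by (subst nn_integral_cmult, measurable) (subst nn_integral_add; measurable)
  qed
  also have "\<dots> < \<infinity>"
    using nn_integral_norm_powr_ball_finite[of p a] nn_integral_sphere_density_powr_finite[of 0] p
    by (auto simp: ennreal_mult_less_top)
  finally show "f \<in> bergman_space p \<Omega>" using hf \<Omega> by (simp add: bergman_space_iff)
  show "simple_pole_in_chart Some a \<rho> f k"
    unfolding simple_pole_in_chart_def
    by (intro exI[of _ "\<lambda>_. k"]) (use sub in \<open>auto simp: f_def\<close>)
qed

text \<open>The witness is k z, admissible since infinity lies outside \<Omega>; its p-th power is
  integrable against a density of order |z|^(-4) because p < 2.\<close>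

lemma bergman_space_contains_simple_pole_at_infinity:
  assumes \<Omega>: "openin sphere_topology \<Omega>" and p: "1 \<le> p" "p < 2" and inf: "None \<notin> \<Omega>"
    and sub: "\<And>w. w \<in> ball 0 \<rho> - {0} \<Longrightarrow> Some (1 / w) \<in> \<Omega>"
  shows "\<exists>f\<in>bergman_space p \<Omega>. simple_pole_in_chart (\<lambda>w. Some (1 / w)) 0 \<rho> f k"
proof
  define f where "f = (\<lambda>x. if x \<in> \<Omega> then (case x of None \<Rightarrow> 0 | Some z \<Rightarrow> k * z) else 0)"
  have "(\<lambda>z. k * z) holomorphic_on {z. Some z \<in> \<Omega>}"
    by (intro holomorphic_intros)
  then have 1: "(\<lambda>z. f (Some z)) holomorphic_on {z. Some z \<in> \<Omega>}"
    by (rule holomorphic_transform) (auto simp: f_def)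
  have "(\<lambda>w. k / w) holomorphic_on {w. sphere_inverse (Some w) \<in> \<Omega>}"
    using inf by (intro holomorphic_intros) auto
  then have 2: "(\<lambda>w. f (sphere_inverse (Some w))) holomorphic_on {w. sphere_inverse (Some w) \<in> \<Omega>}"
    by (rule holomorphic_transform) (use inf in \<open>auto simp: f_def split: if_splits\<close>)
  have hf: "f \<in> sphere_holomorphic \<Omega>"
    using 1 2 by (simp add: sphere_holomorphic_def f_def)
  have "bergman_energy p f \<le> (\<integral>\<^sup>+z. ennreal (cmod k powr p) * ennreal ((1 + cmod z) powr p * sphere_density z) \<partial>lborel)"
    unfolding bergman_energy_def
  proof (rule nn_integral_mono)
    fix z
    have "cmod (f (Some z)) \<le> cmod k * (1 + cmod z)"
      by (auto simp: f_def norm_mult intro!: mult_left_mono)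
    then have "cmod (f (Some z)) powr p \<le> (cmod k * (1 + cmod z)) powr p"
      using p by (intro powr_mono2) auto
    also have "\<dots> = cmod k powr p * (1 + cmod z) powr p" by (simp add: powr_mult)
    finally have "cmod (f (Some z)) powr p * sphere_density z
        \<le> cmod k powr p * (1 + cmod z) powr p * sphere_density z"
      by (intro mult_right_mono) (simp_all add: sphere_density_pos less_imp_le)
    then have "ennreal (cmod (f (Some z)) powr p * sphere_density z)
        \<le> ennreal (cmod k powr p * ((1 + cmod z) powr p * sphere_density z))"
      by (intro ennreal_leI) (simp add: mult.assoc)
    also have "\<dots> = ennreal (cmod k powr p) * ennreal ((1 + cmod z) powr p * sphere_density z)"
      using sphere_density_pos[of z] by (intro ennreal_mult) auto
    finally show "ennreal (cmod (f (Some z)) powr p * sphere_density z)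
        \<le> ennreal (cmod k powr p) * ennreal ((1 + cmod z) powr p * sphere_density z)" .
  qed
  also have "\<dots> = ennreal (cmod k powr p) * (\<integral>\<^sup>+z. ennreal ((1 + cmod z) powr p * sphere_density z) \<partial>lborel)"
    by (rule nn_integral_cmult) measurable
  also have "\<dots> < \<infinity>"
    using nn_integral_sphere_density_powr_finite[of p] p by (auto simp: ennreal_mult_less_top)
  finally show "f \<in> bergman_space p \<Omega>" using hf \<Omega> by (simp add: bergman_space_iff)
  show "simple_pole_in_chart (\<lambda>w. Some (1 / w)) 0 \<rho> f k"
    unfolding simple_pole_in_chart_def
    by (intro exI[of _ "\<lambda>_. k"]) (use sub in \<open>auto simp: f_def\<close>)
qed

theorem mainTheorem4:
  fixes \<Omega> :: "sphere set" and p :: real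
  assumes "openin sphere_topology \<Omega>" and "Some 0 \<in> \<Omega>"
    and "1 \<le> p" and "p < 2"
    and "hypercyclic (bergman_topology p \<Omega>) (taylor_shift \<Omega>)"
  shows "perfect_in sphere_topology (sphere_star \<Omega>)"
  unfolding perfect_in_def
proof (intro conjI ballI)
  note \<Omega> = assms(1)
  show "closedin sphere_topology (sphere_star \<Omega>)" by (rule closedin_sphere_star[OF \<Omega>])
  fix x assume x: "x \<in> sphere_star \<Omega>"
  show "x \<in> sphere_topology derived_set_of sphere_star \<Omega>"
  proof (rule ccontr)
    assume "x \<notin> sphere_topology derived_set_of sphere_star \<Omega>"
    with \<Omega> x show False
    proof (cases rule: sphere_isolated_point_cases)
      case (finite a \<rho>')
      then have a: "a \<noteq> 0" using assms(2) by auto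
      \<comment> \<open>Shrinking to |a| keeps 0, where the shift has its separate formula, out of
        the disc.\<close>
      define \<rho> where "\<rho> = min \<rho>' (cmod a)"
      have \<rho>: "\<rho> > 0" "\<rho> \<le> cmod a" using a finite(1) by (auto simp: \<rho>_def)
      have sub: "Some z \<in> \<Omega>" if "z \<in> ball a \<rho> - {a}" for z
        using finite(3) that by (auto simp: \<rho>_def)
      have "\<not> hypercyclic (bergman_topology p \<Omega>) (taylor_shift \<Omega>)"
      proof (rule not_hypercyclic_if_simple_poles[OF \<Omega> assms(3) \<rho>(1), where c = Some and a = a and \<alpha> = "1 / a"])
        show "Some z \<in> \<Omega>" if "z \<in> sphere a (\<rho> / 2)" for z
          using that \<rho>(1) by (intro sub) auto
      qed (use bergman_simple_pole_at_finite_point[OF \<Omega> assms(3) _ \<rho>(1) sub]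
            taylor_shift_simple_pole_at_finite_point[OF _ \<rho>(2) sub]
            bergman_space_contains_simple_pole_at_finite_point[OF \<Omega> assms(3,4) finite(2) sub] in auto)
      with assms(5) show False by blast
    next
      case (infinite \<rho>)
      have "\<not> hypercyclic (bergman_topology p \<Omega>) (taylor_shift \<Omega>)"
      \<comment> \<open>\<open>K\<close> is the circle |w| = \<rho> / 2 seen in the z-plane, and
        \<alpha> = 0 is the value of 1 / a at a = \<infinity>.\<close>
      proof (rule not_hypercyclic_if_simple_poles[OF \<Omega> assms(3) infinite(1),
            where c = "\<lambda>w. Some (1 / w)" and a = 0 and \<alpha> = 0 and K = "sphere 0 (2 / \<rho>)"])
        show "Some z \<in> \<Omega>" if "z \<in> sphere 0 (2 / \<rho>)" for z
        proof -
          have "1 / z \<in> ball 0 \<rho> - {0}" using that infinite(1) by (auto simp: norm_divide)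
          then show ?thesis using infinite(3)[of "1 / z"] by simp
        qed
        show "(\<lambda>w. Some (1 / w)) ` sphere 0 (\<rho> / 2) \<subseteq> Some ` sphere (0::complex) (2 / \<rho>)"
          using infinite(1) by (intro image_subsetI imageI) (auto simp: norm_divide)
      qed (use bergman_simple_pole_at_infinity[OF \<Omega> assms(3) _ infinite(1,3)]
            taylor_shift_simple_pole_at_infinity[OF _ infinite(3)]
            bergman_space_contains_simple_pole_at_infinity[OF \<Omega> assms(3,4) infinite(2,3)] in auto)
      with assms(5) show False by blast
    qed
  qed
qed

end
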